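(* Let $M=S^2(-\frac{q_1}{p_1},-\frac{q_2}{p_2},\frac{q_3}{p_3})$ be a small Seifert manifold, with $\pi_1(M)=\langle h,c_1,c_2\mid hc_1=c_1h,\ hc_2=c_2h,\ c_i^{p_i}=h^{q_i}\ (i=1,2,3)\rangle$ where $c_3:=c_1c_2$. Set $u=t_h$, $x_i=t_{c_i}$, $y_i=t_{hc_i}$ ($i=1,2,3$). Then $\mathbb{C}[{\mathcal{X}}(M)]$ is isomorphic (via the map sending the variables to these elements) to the quotient of $\mathbb{C}[u,x_1,x_2,x_3,y_1,y_2,y_3]$ by the ideal generated by: (1) $u^2+x_i^2+y_i^2-ux_iy_i-4$, $i=1,2,3$; (2) $2y_i-(ux_i+x_jy_3-x_3y_j)$, $\{i,j\}=\{1,2\}$; (3) $2y_3-(u(x_3-x_1x_2)+y_1x_2+y_2x_1)$; (4) $2x_3-(uy_3+x_1x_2-y_1y_2)$; (5) $T_{q_i}(u)-T_{p_i}(x_i)$, $i=1,2,3$; (6) $T_{q_i+1}(u)-S_{p_i}(x_i)y_i+S_{p_i-1}(x_i)u$, $i=1,2,3$; (7) $S_{q_i}(u)y_i-S_{q_i-1}(u)x_i-T_{p_i+1}(x_i)$, $i=1,2,3$; (8) $S_{q_i}(u)y_j-S_{q_i-1}(u)x_j-S_{p_i}(x_i)x_3+S_{p_i-1}(x_i)x_j$, $\{i,j\}=\{1,2\}$; (9) $S_{q_i+1}(u)y_i-S_{q_i}(u)x_i-S_{p_i+1}(x_i)y_i+S_{p_i}(x_i)u$, $i=1,2,3$; (10)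 $S_{q_i}(u)y_k-S_{q_i-1}(u)x_k-S_{p_i+1}(x_i)x_k+S_{p_i}(x_i)x_j$, for $i,j,k$ pairwise distinct in $\{1,2,3\}$ with $j\neq3$; (11) $S_{q_i+1}(u)y_j-S_{q_i}(u)x_j-S_{p_i}(x_i)y_3+S_{p_i-1}(x_i)y_j$, $\{i,j\}=\{1,2\}$; (12) $S_{q_3+1}(u)y_i-S_{q_3}(u)x_i-S_{p_3}(x_3)(x_iy_3-y_j)+S_{p_3-1}(x_3)y_i$, $\{i,j\}=\{1,2\}$.
   Context: Here $p_i\ge2$ and $q_i$ are integers with $\gcd(p_i,q_i)=1$. $\mathbb{C}[{\mathcal{X}}(M)]=\mathbb{C}[{\mathcal{X}}(\pi_1(M))]$ is the coordinate ring of the $\mathrm{SL}_2(\mathbb{C})$-character scheme; equivalently, the commutative $\mathbb{C}$-algebra generated by symbols $t_x$, $x\in\pi_1(M)$, subject to $t_{xy}+t_{xy^{-1}}=t_xt_y$, $t_{xy}=t_{yx}$ and $t_1=2$. The Chebyshev polynomials are $T_0=2$, $T_1=X$, $T_{n+1}=XT_n-T_{n-1}$, $S_0=0$, $S_1=1$, $S_{n+1}=XS_n-S_{n-1}$, extended to all integers $n$ by the recurrence ($T_{-n}=T_n$, $S_{-n}=-S_n$). *)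

theory Defs
  imports Complex_Main "HOL-Library.Poly_Mapping"
begin

fun chebT_nat :: "nat \<Rightarrow> 'a::comm_ring_1 \<Rightarrow> 'a" where
  "chebT_nat 0 X = 2"
| "chebT_nat (Suc 0) X = X"
| "chebT_nat (Suc (Suc n)) X = X * chebT_nat (Suc n) X - chebT_nat n X"

fun chebS_nat :: "nat \<Rightarrow> 'a::comm_ring_1 \<Rightarrow> 'a" where
  "chebS_nat 0 X = 0"
| "chebS_nat (Suc 0) X = 1"
| "chebS_nat (Suc (Suc n)) X = X * chebS_nat (Suc n) X - chebS_nat n X"

text \<open>T_{-n} = T_n, S_{-n} = - S_n (consistent with the recurrence).\<close>
definition chebT :: "int \<Rightarrow> 'a::comm_ring_1 \<Rightarrow> 'a" where
  "chebT n X = chebT_nat (nat \<bar>n\<bar>) X"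

definition chebS :: "int \<Rightarrow> 'a::comm_ring_1 \<Rightarrow> 'a" where
  "chebS n X = (if 0 \<le> n then chebS_nat (nat n) X else - chebS_nat (nat (- n)) X)"

type_synonym 'v mpoly = "('v \<Rightarrow>\<^sub>0 nat) \<Rightarrow>\<^sub>0 complex"

definition mvar :: "'v \<Rightarrow> 'v mpoly" where
  "mvar v = Poly_Mapping.single (Poly_Mapping.single v 1) 1"

definition mconst :: "complex \<Rightarrow> 'v mpoly" where
  "mconst c = Poly_Mapping.single 0 c"

definition msubst :: "('v \<Rightarrow> 'w mpoly) \<Rightarrow> 'v mpoly \<Rightarrow> 'w mpoly" where
  "msubst \<sigma> P = (\<Sum>m\<in>Poly_Mapping.keys P.
      mconst (Poly_Mapping.lookup P m) * (\<Prod>v\<in>Poly_Mapping.keys m. \<sigma> v ^ Poly_Mapping.lookup m v))"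

inductive_set ideal_gen :: "'a::comm_ring_1 set \<Rightarrow> 'a set" for S where
  zero: "0 \<in> ideal_gen S"
| gen: "s \<in> S \<Longrightarrow> r * s \<in> ideal_gen S"
| add: "a \<in> ideal_gen S \<Longrightarrow> b \<in> ideal_gen S \<Longrightarrow> a + b \<in> ideal_gen S"

datatype gen = Gh | Gc1 | Gc2

text \<open>Words in the generators and their inverses; (g, True) is the letter g^{-1}.\<close>
type_synonym word = "(gen \<times> bool) list"

definition winv :: "word \<Rightarrow> word" where
  "winv w = rev (map (\<lambda>(g, b). (g, \<not> b)) w)"

definition wpow :: "word \<Rightarrow> int \<Rightarrow> word" where
  "wpow w k = (if 0 \<le> k then concat (replicate (nat k) w) else concat (replicate (nat (- k)) (winv w)))"

definition wh :: word where "wh = [(Gh, False)]"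
definition wc1 :: word where "wc1 = [(Gc1, False)]"
definition wc2 :: word where "wc2 = [(Gc2, False)]"

definition wc :: "nat \<Rightarrow> word" where
  "wc i = (if i = 1 then wc1 else if i = 2 then wc2 else wc1 @ wc2)"

inductive pi1_eq :: "(nat \<Rightarrow> int) \<Rightarrow> (nat \<Rightarrow> int) \<Rightarrow> word \<Rightarrow> word \<Rightarrow> bool" for p q where
  refl: "pi1_eq p q w w"
| sym: "pi1_eq p q v w \<Longrightarrow> pi1_eq p q w v"
| trans: "pi1_eq p q u v \<Longrightarrow> pi1_eq p q v w \<Longrightarrow> pi1_eq p q u w"
| cong: "pi1_eq p q v w \<Longrightarrow> pi1_eq p q (a @ v @ b) (a @ w @ b)"
| cancel: "pi1_eq p q [(g, b), (g, \<not> b)] []"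
| rel_h1: "pi1_eq p q (wh @ wc1) (wc1 @ wh)"
| rel_h2: "pi1_eq p q (wh @ wc2) (wc2 @ wh)"
| rel_c: "i \<in> {1, 2, 3} \<Longrightarrow> pi1_eq p q (wpow (wc i) (p i)) (wpow wh (q i))"

text \<open>C[X(pi_1 M)] = C[t_w : w words] / J, where J identifies t_v = t_w for v = w in pi_1(M)
  and imposes t_{xy} + t_{xy^{-1}} = t_x t_y, t_{xy} = t_{yx}, t_1 = 2.\<close>
definition char_rels :: "(nat \<Rightarrow> int) \<Rightarrow> (nat \<Rightarrow> int) \<Rightarrow> word mpoly set" where
  "char_rels p q =
     {mvar v - mvar w | v w. pi1_eq p q v w}
   \<union> {mvar (a @ b) + mvar (a @ winv b) - mvar a * mvar b | a b. True}
   \<union> {mvar (a @ b) - mvar (b @ a) | a b. True}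
   \<union> {mvar [] - 2}"

definition char_ideal :: "(nat \<Rightarrow> int) \<Rightarrow> (nat \<Rightarrow> int) \<Rightarrow> word mpoly set" where
  "char_ideal p q = ideal_gen (char_rels p q)"

datatype svar = U | X1 | X2 | X3 | Y1 | Y2 | Y3

definition xv :: "nat \<Rightarrow> svar" where
  "xv i = (if i = 1 then X1 else if i = 2 then X2 else X3)"
definition yv :: "nat \<Rightarrow> svar" where
  "yv i = (if i = 1 then Y1 else if i = 2 then Y2 else Y3)"

definition seifert_rels :: "(nat \<Rightarrow> int) \<Rightarrow> (nat \<Rightarrow> int) \<Rightarrow> svar mpoly set" where
  "seifert_rels p q =
    (let u = mvar U; x = (\<lambda>i. mvar (xv i)); y = (\<lambda>i. mvar (yv i)) in
       {u^2 + (x i)^2 + (y i)^2 - u * x i * y i - 4 | i. i \<in> {1, 2, 3}}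
     \<union> {2 * y i - (u * x i + x j * y 3 - x 3 * y j) | i j. (i, j) \<in> {(1, 2), (2, 1)}}
     \<union> {2 * y 3 - (u * (x 3 - x 1 * x 2) + y 1 * x 2 + y 2 * x 1)}
     \<union> {2 * x 3 - (u * y 3 + x 1 * x 2 - y 1 * y 2)}
     \<union> {chebT (q i) u - chebT (p i) (x i) | i. i \<in> {1, 2, 3}}
     \<union> {chebT (q i + 1) u - chebS (p i) (x i) * y i + chebS (p i - 1) (x i) * u | i. i \<in> {1, 2, 3}}
     \<union> {chebS (q i) u * y i - chebS (q i - 1) u * x i - chebT (p i + 1) (x i) | i. i \<in> {1, 2, 3}}
     \<union> {chebS (q i) u * y j - chebS (q i - 1) u * x j - chebS (p i) (x i) * x 3
          + chebS (p i - 1) (x i) * x j | i j. (i, j) \<in> {(1, 2), (2, 1)}}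
     \<union> {chebS (q i + 1) u * y i - chebS (q i) u * x i - chebS (p i + 1) (x i) * y i
          + chebS (p i) (x i) * u | i. i \<in> {1, 2, 3}}
     \<union> {chebS (q i) u * y k - chebS (q i - 1) u * x k - chebS (p i + 1) (x i) * x k
          + chebS (p i) (x i) * x j | i j k.
            i \<in> {1, 2, 3} \<and> j \<in> {1, 2, 3} \<and> k \<in> {1, 2, 3} \<and> i \<noteq> j \<and> j \<noteq> k \<and> i \<noteq> k \<and> j \<noteq> 3}
     \<union> {chebS (q i + 1) u * y j - chebS (q i) u * x j - chebS (p i) (x i) * y 3
          + chebS (p i - 1) (x i) * y j | i j. (i, j) \<in> {(1, 2), (2, 1)}}
     \<union> {chebS (q 3 + 1) u * y i - chebS (q 3) u * x i - chebS (p 3) (x 3) * (x i * y 3 - y j)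
          + chebS (p 3 - 1) (x 3) * y i | i j. (i, j) \<in> {(1, 2), (2, 1)}})"

definition seifert_ideal :: "(nat \<Rightarrow> int) \<Rightarrow> (nat \<Rightarrow> int) \<Rightarrow> svar mpoly set" where
  "seifert_ideal p q = ideal_gen (seifert_rels p q)"

definition svar_word :: "svar \<Rightarrow> word" where
  "svar_word v = (case v of U \<Rightarrow> wh
     | X1 \<Rightarrow> wc 1 | X2 \<Rightarrow> wc 2 | X3 \<Rightarrow> wc 3
     | Y1 \<Rightarrow> wh @ wc 1 | Y2 \<Rightarrow> wh @ wc 2 | Y3 \<Rightarrow> wh @ wc 3)"

definition trace_map :: "svar mpoly \<Rightarrow> word mpoly" where
  "trace_map = msubst (\<lambda>v. mvar (svar_word v))"

end

theory Submission
  imports Defs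
begin

text \<open>Up to the central element \<open>h\<close>, words in \<open>c\<^sub>1, c\<^sub>2\<close> live in the universal quaternion algebra
  over the polynomial ring, free with basis \<open>1, a, b, a b\<close>, where the generic trace is computed.
  The trace of \<open>x h\<^sup>k\<close> is determined by the two linear functionals
  \<open>x \<mapsto> t(x)\<close> and \<open>x \<mapsto> t(h x)\<close> through Chebyshev polynomials in \<open>u\<close>; the second one sends
  \<open>1, a, b, a b\<close> to \<open>u, y\<^sub>1, y\<^sub>2, y\<^sub>3\<close>. This assigns a polynomial to every word and gives a map
  from symbols \<open>t(w)\<close> to polynomials that inverts the given one. Relations (2), (3) say exactly that
  the second functional is cyclic, (1) and (4) then give
  \<open>t(x y) + t(x y\<^sup>-\<^sup>1) = t(x) t(y)\<close> for all words, and (5)--(12) are the identities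
  \<open>t(x c\<^sub>i\<^sup>p y) = t(x h\<^sup>q y)\<close> for \<open>x y\<close> in a basis of the algebra, except for two redundant ones.\<close>

section \<open>Chebyshev polynomials of integer index\<close>

lemma chebS_0 [simp]: "chebS 0 X = 0"
  by (simp add: chebS_def)

lemma chebS_1 [simp]: "chebS 1 X = 1"
  by (simp add: chebS_def)

lemma chebS_minus: "chebS (- n) X = - chebS n X"
  by (simp add: chebS_def)

lemma chebS_minus_1 [simp]: "chebS (- 1) X = - 1"
  using chebS_minus[of 1 X] by simp

lemma chebS_int_Suc: "chebS (int n + 2) X = X * chebS (int n + 1) X - chebS (int n) X"
proof -
  have "nat (int n + 2) = Suc (Suc n)" "nat (int n + 1) = Suc n" by auto
  then show ?thesis by (simp add: chebS_def)
qed

lemma chebS_rec: "chebS (k + 1) X = X * chebS k X - chebS (k - 1) X"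
proof -
  consider n where "k = int n + 1" | "k = 0" | n where "k = - (int n + 1)"
    by (metis add.commute int_cases int_of_nat_induct minus_add_distrib nat_int of_nat_Suc
        old.nat.exhaust semiring_1_class.of_nat_0)
  then show ?thesis
  proof cases
    case (1 n)
    then show ?thesis using chebS_int_Suc[of n X] by (simp add: add.commute)
  next
    case 2
    then show ?thesis by simp
  next
    case (3 n)
    have "k + 1 = - int n" "k - 1 = - (int n + 2)" using 3 by auto
    then show ?thesis using 3 chebS_int_Suc[of n X]
      by (simp only: chebS_minus) (simp add: algebra_simps)
  qed
qed

text \<open>A solution of the two-sided recurrence is determined by its values at 0 and 1;
  \<open>chebS k X\<close> and \<open>- chebS (k - 1) X\<close> are the solutions with initial
  values (0, 1) and (1, 0). Two consecutive values are carried along so that the induction runs in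
  both directions.\<close>

lemma chebyshev_recurrence:
  fixes f :: "int \<Rightarrow> 'a::comm_ring_1"
  assumes "\<And>k. f (k + 1) = X * f k - f (k - 1)"
  shows "f k = chebS k X * f 1 - chebS (k - 1) X * f 0"
proof -
  have *: "f k = chebS k X * f 1 - chebS (k - 1) X * f 0 \<and>
        f (k + 1) = chebS (k + 1) X * f 1 - chebS k X * f 0"
  proof (induction k rule: int_induct[where k = 0])
    case base
    show ?case by simp
  next
    case (step1 i)
    have "f (i + 1 + 1) = X * f (i + 1) - f i"
      using assms[of "i + 1"] by simp
    moreover have "chebS (i + 1 + 1) X = X * chebS (i + 1) X - chebS i X"
      using chebS_rec[of "i + 1" X] by simp
    moreover have "chebS (i - 1) X = X * chebS i X - chebS (i + 1) X"
      using chebS_rec[of i X] by simp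
    ultimately show ?case
      using step1.IH by (simp add: right_diff_distrib left_diff_distrib mult_ac)
  next
    case (step2 i)
    have "f (i - 1) = X * f i - f (i + 1)"
      using assms[of i] by simp
    moreover have "chebS (i - 1 - 1) X = X * chebS (i - 1) X - chebS i X"
      using chebS_rec[of "i - 1" X] by simp
    moreover have "chebS (i + 1) X = X * chebS i X - chebS (i - 1) X"
      using chebS_rec[of i X] by simp
    ultimately show ?case
      using step2.IH by (simp add: right_diff_distrib left_diff_distrib mult_ac)
  qed
  then show ?thesis by simp
qed

lemma chebT_rec: "chebT (k + 1) X = X * chebT k X - chebT (k - 1) X"
proof -
  have nat_case: "chebT (int n + 2) X = X * chebT (int n + 1) X - chebT (int n) X" for n
  proof -
    have "nat \<bar>int n + 2\<bar> = Suc (Suc n)" "nat \<bar>int n + 1\<bar> = Suc n" by auto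
    then show ?thesis by (simp add: chebT_def)
  qed
  have minus: "chebT (- n) X = chebT n X" for n
    by (simp add: chebT_def)
  consider n where "k = int n + 1" | "k = 0" | n where "k = - (int n + 1)"
    by (metis add.commute int_cases int_of_nat_induct minus_add_distrib nat_int of_nat_Suc
        old.nat.exhaust semiring_1_class.of_nat_0)
  then show ?thesis
  proof cases
    case (1 n)
    then show ?thesis using nat_case[of n] by (simp add: add.commute)
  next
    case 2
    then show ?thesis by (simp add: chebT_def)
  next
    case (3 n)
    have "k + 1 = - int n" "k - 1 = - (int n + 2)" using 3 by auto
    then show ?thesis using 3 nat_case[of n]
      by (simp only: minus) (simp add: algebra_simps)
  qed
qed

lemma chebT_conv_chebS: "chebT k X = chebS k X * X - chebS (k - 1) X * 2"
  using chebyshev_recurrence[of "\<lambda>k. chebT k X" X k, OF chebT_rec]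
  by (simp add: chebT_def)

text \<open>For fixed \<open>l\<close> the left side is, as a function of \<open>k\<close>, the
  solution of the recurrence with values \<open>chebS l X\<close> at 0 and
  \<open>chebS (l + 1) X\<close> at 1.\<close>

lemma chebS_add: "chebS (k + l) X = chebS k X * chebS (l + 1) X - chebS (k - 1) X * chebS l X"
proof -
  have "chebS (k + 1 + l) X = X * chebS (k + l) X - chebS (k - 1 + l) X" for k
    using chebS_rec[of "k + l" X] by (simp add: algebra_simps)
  from chebyshev_recurrence[of "\<lambda>k. chebS (k + l) X" X k, OF this]
  show ?thesis by (simp add: add.commute)
qed

section \<open>Ideals\<close>

lemma ideal_gen_base: "s \<in> S \<Longrightarrow> s \<in> ideal_gen S"
  using ideal_gen.gen[of s S 1] by simp

lemma ideal_gen_mult_left: "a \<in> ideal_gen S \<Longrightarrow> r * a \<in> ideal_gen S"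
proof (induction rule: ideal_gen.induct)
  case (gen s r')
  then show ?case using ideal_gen.gen[of s S "r * r'"] by (simp add: mult.assoc)
qed (auto simp: distrib_left intro: ideal_gen.intros)

lemma ideal_gen_uminus: "a \<in> ideal_gen S \<Longrightarrow> - a \<in> ideal_gen S"
  using ideal_gen_mult_left[of a S "- 1"] by simp

lemma ideal_gen_diff: "a \<in> ideal_gen S \<Longrightarrow> b \<in> ideal_gen S \<Longrightarrow> a - b \<in> ideal_gen S"
  using ideal_gen.add[OF _ ideal_gen_uminus, of a S b] by simp

lemmas ideal_gen_rules =
  ideal_gen.zero ideal_gen.add ideal_gen_diff ideal_gen_uminus
  ideal_gen_mult_left

section \<open>Congruence modulo an ideal\<close>

definition ideal_cong :: "'a::comm_ring_1 set \<Rightarrow> 'a \<Rightarrow> 'a \<Rightarrow> bool" where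
  "ideal_cong S a b \<longleftrightarrow> a - b \<in> ideal_gen S"

lemma ideal_cong_refl: "ideal_cong S a a"
  by (simp add: ideal_cong_def ideal_gen.zero)

lemma ideal_cong_trans [trans]: "ideal_cong S a b \<Longrightarrow> ideal_cong S b c \<Longrightarrow> ideal_cong S a c"
  using ideal_gen.add[of "a - b" S "b - c"] by (simp add: ideal_cong_def)

lemma ideal_cong_add:
  "ideal_cong S a b \<Longrightarrow> ideal_cong S c d \<Longrightarrow> ideal_cong S (a + c) (b + d)"
  using ideal_gen.add[of "a - b" S "c - d"] by (simp add: ideal_cong_def algebra_simps)

lemma ideal_cong_diff:
  "ideal_cong S a b \<Longrightarrow> ideal_cong S c d \<Longrightarrow> ideal_cong S (a - c) (b - d)"
  using ideal_gen_diff[of "a - b" S "c - d"] by (simp add: ideal_cong_def algebra_simps)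

lemma ideal_cong_mult:
  assumes "ideal_cong S a b" "ideal_cong S c d"
  shows "ideal_cong S (a * c) (b * d)"
proof -
  have "c * (a - b) + b * (c - d) \<in> ideal_gen S"
    using assms by (auto simp: ideal_cong_def intro: ideal_gen_rules)
  then show ?thesis by (simp add: ideal_cong_def algebra_simps)
qed

lemma ideal_cong_power: "ideal_cong S a b \<Longrightarrow> ideal_cong S (a ^ n) (b ^ n)"
  by (induction n) (auto intro: ideal_cong_refl ideal_cong_mult)

lemma ideal_cong_sum:
  "(\<And>x. x \<in> A \<Longrightarrow> ideal_cong S (f x) (g x)) \<Longrightarrow> ideal_cong S (sum f A) (sum g A)"
  by (induction A rule: infinite_finite_induct) (auto intro: ideal_cong_refl ideal_cong_add)

lemma ideal_cong_prod:
  "(\<And>x. x \<in> A \<Longrightarrow> ideal_cong S (f x) (g x)) \<Longrightarrow> ideal_cong S (prod f A) (prod g A)"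
  by (induction A rule: infinite_finite_induct) (auto intro: ideal_cong_refl ideal_cong_mult)

lemma ideal_cong_mem_iff: "ideal_cong S a b \<Longrightarrow> a \<in> ideal_gen S \<longleftrightarrow> b \<in> ideal_gen S"
  using ideal_gen.add[of "a - b" S b] ideal_gen_diff[of a S "a - b"] by (auto simp: ideal_cong_def)

section \<open>Substitution in polynomials\<close>

lemma mconst_0 [simp]: "mconst 0 = 0"
  and mconst_1 [simp]: "mconst 1 = 1"
  and mconst_add: "mconst (c + d) = mconst c + mconst d"
  and mconst_mult: "mconst (c * d) = mconst c * mconst d"
  by (simp_all add: mconst_def single_add mult_single)

lemma mconst_numeral: "mconst (numeral n) = numeral n"
  by (simp add: mconst_def)

definition monom_subst :: "('v \<Rightarrow> 'w mpoly) \<Rightarrow> ('v \<Rightarrow>\<^sub>0 nat) \<Rightarrow> 'w mpoly" where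
  "monom_subst \<sigma> m = (\<Prod>v\<in>Poly_Mapping.keys m. \<sigma> v ^ Poly_Mapping.lookup m v)"

lemma monom_subst_superset:
  assumes "finite A" "Poly_Mapping.keys m \<subseteq> A"
  shows "monom_subst \<sigma> m = (\<Prod>v\<in>A. \<sigma> v ^ Poly_Mapping.lookup m v)"
  unfolding monom_subst_def
  by (rule prod.mono_neutral_left) (use assms in \<open>auto simp: in_keys_iff\<close>)

lemma monom_subst_0 [simp]: "monom_subst \<sigma> 0 = 1"
  by (simp add: monom_subst_def)

lemma monom_subst_add: "monom_subst \<sigma> (m + n) = monom_subst \<sigma> m * monom_subst \<sigma> n"
proof -
  let ?A = "Poly_Mapping.keys m \<union> Poly_Mapping.keys n"
  have "monom_subst \<sigma> (m + n) = (\<Prod>v\<in>?A. \<sigma> v ^ Poly_Mapping.lookup (m + n) v)"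
    by (rule monom_subst_superset) (auto simp: keys_add)
  also have "\<dots> = (\<Prod>v\<in>?A. \<sigma> v ^ Poly_Mapping.lookup m v) * (\<Prod>v\<in>?A. \<sigma> v ^ Poly_Mapping.lookup n v)"
    by (simp add: lookup_add power_add prod.distrib)
  also have "\<dots> = monom_subst \<sigma> m * monom_subst \<sigma> n"
    by (simp add: monom_subst_superset[of ?A])
  finally show ?thesis .
qed

lemma msubst_altdef:
  "msubst \<sigma> P = (\<Sum>m\<in>Poly_Mapping.keys P. mconst (Poly_Mapping.lookup P m) * monom_subst \<sigma> m)"
  by (simp add: msubst_def monom_subst_def)

lemma msubst_superset:
  assumes "finite A" "Poly_Mapping.keys P \<subseteq> A"
  shows "msubst \<sigma> P = (\<Sum>m\<in>A. mconst (Poly_Mapping.lookup P m) * monom_subst \<sigma> m)"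
  unfolding msubst_altdef
  by (rule sum.mono_neutral_left) (use assms in \<open>auto simp: in_keys_iff\<close>)

lemma msubst_single: "msubst \<sigma> (Poly_Mapping.single m c) = mconst c * monom_subst \<sigma> m"
  by (subst msubst_superset[of "{m}"]) (auto split: if_splits)

lemma msubst_0 [simp]: "msubst \<sigma> 0 = 0"
  by (simp add: msubst_altdef)

lemma msubst_add [simp]: "msubst \<sigma> (P + Q) = msubst \<sigma> P + msubst \<sigma> Q"
proof -
  let ?A = "Poly_Mapping.keys P \<union> Poly_Mapping.keys Q"
  have "msubst \<sigma> (P + Q) = (\<Sum>m\<in>?A. mconst (Poly_Mapping.lookup (P + Q) m) * monom_subst \<sigma> m)"
    by (rule msubst_superset) (auto simp: keys_add)
  also have "\<dots> = msubst \<sigma> P + msubst \<sigma> Q"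
    by (simp add: msubst_superset[of ?A] lookup_add mconst_add distrib_right sum.distrib)
  finally show ?thesis .
qed

lemma msubst_uminus [simp]: "msubst \<sigma> (- P) = - msubst \<sigma> P"
  using msubst_add[of \<sigma> "- P" P] by (simp del: msubst_add add: eq_neg_iff_add_eq_0)

lemma msubst_diff [simp]: "msubst \<sigma> (P - Q) = msubst \<sigma> P - msubst \<sigma> Q"
  using msubst_add[of \<sigma> P "- Q"] by simp

text \<open>Reduces an additive property to single terms, so that multiplicativity of substitution
  has to be compared on monomials only.\<close>

lemma mpoly_induct [case_names single add]:
  fixes P :: "'v mpoly"
  assumes "\<And>m c. R (Poly_Mapping.single m c)"
    and "\<And>P Q. R P \<Longrightarrow> R Q \<Longrightarrow> R (P + Q)"
  shows "R P"
proof (induction P rule: Poly_Mapping.update_induct)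
  case const
  show ?case using assms(1)[of 0 0] by simp
next
  case (update f a b)
  have "Poly_Mapping.update a b f = f + Poly_Mapping.single a b"
    using update.hyps
    by (intro poly_mapping_eqI)
      (auto simp: lookup_update lookup_add lookup_single when_def in_keys_iff)
  then show ?case using assms update.IH by simp
qed

lemma msubst_mult [simp]: "msubst \<sigma> (P * Q) = msubst \<sigma> P * msubst \<sigma> Q"
proof (induction P rule: mpoly_induct)
  case (single m c)
  show ?case
  proof (induction Q rule: mpoly_induct)
    case (single n d)
    show ?case
      by (simp add: mult_single msubst_single mconst_mult monom_subst_add mult_ac)
  qed (simp add: algebra_simps)
qed (simp add: algebra_simps)

lemma msubst_mconst [simp]: "msubst \<sigma> (mconst c) = mconst c"
  by (simp add: mconst_def msubst_single)

lemma msubst_1 [simp]: "msubst \<sigma> 1 = 1"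
  using msubst_mconst[of \<sigma> 1] by simp

lemma msubst_numeral [simp]: "msubst \<sigma> (numeral n) = numeral n"
  using msubst_mconst[of \<sigma> "numeral n"] by (simp add: mconst_numeral)

lemma msubst_power [simp]: "msubst \<sigma> (P ^ n) = msubst \<sigma> P ^ n"
  by (induction n) simp_all

lemma msubst_prod: "msubst \<sigma> (prod f A) = (\<Prod>x\<in>A. msubst \<sigma> (f x))"
  by (induction A rule: infinite_finite_induct) simp_all

lemma msubst_mvar [simp]: "msubst \<sigma> (mvar v) = \<sigma> v"
  by (simp add: mvar_def msubst_single monom_subst_def)

lemma msubst_chebS [simp]: "msubst \<sigma> (chebS k P) = chebS k (msubst \<sigma> P)"
proof -
  have "msubst \<sigma> (chebS_nat n P) = chebS_nat n (msubst \<sigma> P)" for n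
    by (induction n P rule: chebS_nat.induct) simp_all
  then show ?thesis by (simp add: chebS_def)
qed

lemma mconst_monom: "mconst c * monom_subst mvar m = Poly_Mapping.single m c"
proof -
  have "monom_subst mvar m = Poly_Mapping.single m 1"
  proof (induction m rule: Poly_Mapping.update_induct)
    case const
    show ?case by simp
  next
    case (update f a b)
    have upd: "Poly_Mapping.update a b f = f + Poly_Mapping.single a b"
      using update.hyps
      by (intro poly_mapping_eqI)
        (auto simp: lookup_update lookup_add lookup_single when_def in_keys_iff)
    have pow: "mvar a ^ n = Poly_Mapping.single (Poly_Mapping.single a n) (1 :: complex)" for n
      by (induction n) (simp_all add: mvar_def mult_single flip: single_add)
    have "monom_subst mvar (Poly_Mapping.single a b) = Poly_Mapping.single (Poly_Mapping.single a b) 1"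
      by (subst monom_subst_superset[of "{a}"]) (auto simp: pow)
    then show ?case by (simp add: upd monom_subst_add update.IH mult_single)
  qed
  then show ?thesis by (simp add: mconst_def mult_single)
qed

lemma msubst_mvar_id: "msubst mvar P = P"
  by (induction P rule: mpoly_induct) (simp_all add: msubst_single mconst_monom)

lemma msubst_msubst: "msubst \<sigma> (msubst \<tau> P) = msubst (\<lambda>v. msubst \<sigma> (\<tau> v)) P"
proof (induction P rule: mpoly_induct)
  case (single m c)
  show ?case by (simp add: msubst_single) (simp add: monom_subst_def msubst_prod)
qed simp

lemma msubst_ideal_cong:
  assumes "\<And>v. ideal_cong S (\<sigma> v) (\<tau> v)"
  shows "ideal_cong S (msubst \<sigma> P) (msubst \<tau> P)"
  unfolding msubst_altdef monom_subst_def
  by (intro ideal_cong_sum ideal_cong_mult ideal_cong_prod ideal_cong_power ideal_cong_refl assms)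

text \<open>The criterion for a substitution to descend to quotient rings; it serves both directions
  of the final kernel computation.\<close>

lemma msubst_ideal_gen:
  assumes "\<And>s. s \<in> S \<Longrightarrow> msubst \<sigma> s \<in> ideal_gen S'" and "P \<in> ideal_gen S"
  shows "msubst \<sigma> P \<in> ideal_gen S'"
  using assms(2) by (induction rule: ideal_gen.induct) (auto intro: ideal_gen_rules assms(1))

section \<open>The algebra of a pair of unimodular elements\<close>

abbreviation "u \<equiv> mvar U"
abbreviation "x1 \<equiv> mvar X1"
abbreviation "x2 \<equiv> mvar X2"
abbreviation "x3 \<equiv> mvar X3"
abbreviation "y1 \<equiv> mvar Y1"
abbreviation "y2 \<equiv> mvar Y2"
abbreviation "y3 \<equiv> mvar Y3"

text \<open>\<open>Quat r0 r1 r2 r3\<close> stands for \<open>r0 + r1 a + r2 b + r3 a b\<close>, where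
  \<open>a + a\<^sup>-\<^sup>1 = x1\<close>, \<open>b + b\<^sup>-\<^sup>1 = x2\<close> and \<open>a b + (a b)\<^sup>-\<^sup>1 = x3\<close>.\<close>

datatype quat = Quat "svar mpoly" "svar mpoly" "svar mpoly" "svar mpoly"

instantiation quat :: ring_1
begin

definition zero_quat :: quat where "0 = Quat 0 0 0 0"
definition one_quat :: quat where "1 = Quat 1 0 0 0"

fun plus_quat :: "quat \<Rightarrow> quat \<Rightarrow> quat" where
  "Quat r0 r1 r2 r3 + Quat s0 s1 s2 s3 = Quat (r0 + s0) (r1 + s1) (r2 + s2) (r3 + s3)"

fun minus_quat :: "quat \<Rightarrow> quat \<Rightarrow> quat" where
  "Quat r0 r1 r2 r3 - Quat s0 s1 s2 s3 = Quat (r0 - s0) (r1 - s1) (r2 - s2) (r3 - s3)"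

fun uminus_quat :: "quat \<Rightarrow> quat" where
  "- Quat r0 r1 r2 r3 = Quat (- r0) (- r1) (- r2) (- r3)"

text \<open>The structure constants come from \<open>a^2 = x1 a - 1\<close>,
  \<open>b^2 = x2 b - 1\<close>, \<open>(a b)^2 = x3 a b - 1\<close> and
  \<open>b a = x3 - x1 x2 + x2 a + x1 b - a b\<close>; the last is the polarized Cayley-Hamilton
  identity.\<close>

fun times_quat :: "quat \<Rightarrow> quat \<Rightarrow> quat" where
  "Quat r0 r1 r2 r3 * Quat s0 s1 s2 s3 = Quat
     (r0 * s0 - r1 * s1 + (x3 - x1 * x2) * r2 * s1 - r2 * s2 - x1 * r2 * s3 - x2 * r3 * s1 - r3 * s3)
     (r0 * s1 + r1 * s0 + x1 * r1 * s1 + x2 * r2 * s1 + r2 * s3 + x3 * r3 * s1 - r3 * s2)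
     (r0 * s2 + r2 * s0 - r1 * s3 + x1 * r2 * s1 + x2 * r2 * s2 + x3 * r2 * s3 + r3 * s1)
     (r0 * s3 + r3 * s0 + r1 * s2 + x1 * r1 * s3 - r2 * s1 + x2 * r3 * s2 + x3 * r3 * s3)"

instance
proof
  fix x y z :: quat
  show "x + y + z = x + (y + z)"
    by (cases x; cases y; cases z) (simp add: add.assoc)
  show "x + y = y + x"
    by (cases x; cases y) (simp add: add.commute)
  show "0 + x = x"
    by (cases x) (simp add: zero_quat_def)
  show "- x + x = 0"
    by (cases x) (simp add: zero_quat_def)
  show "x - y = x + - y"
    by (cases x; cases y) simp
  show "x * y * z = x * (y * z)"
    by (cases x; cases y; cases z) (simp add: algebra_simps)
  show "1 * x = x" "x * 1 = x"
    by (cases x, simp add: one_quat_def)+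
  show "(x + y) * z = x * z + y * z" "x * (y + z) = x * y + x * z"
    by (cases x; cases y; cases z; simp add: algebra_simps)+
  show "(0 :: quat) \<noteq> 1"
    by (simp add: zero_quat_def one_quat_def)
qed

end

definition qscale :: "svar mpoly \<Rightarrow> quat \<Rightarrow> quat" where
  "qscale r x = Quat r 0 0 0 * x"

lemma qscale_Quat [simp]: "qscale r (Quat s0 s1 s2 s3) = Quat (r * s0) (r * s1) (r * s2) (r * s3)"
  by (simp add: qscale_def)

lemma qscale_mult_left: "qscale r x * y = qscale r (x * y)"
  by (simp add: qscale_def mult.assoc)

lemma qscale_mult_right: "x * qscale r y = qscale r (x * y)"
  by (cases x; cases y) (simp add: algebra_simps)

definition qa :: quat where "qa = Quat 0 1 0 0"
definition qb :: quat where "qb = Quat 0 0 1 0"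

definition qgen :: "nat \<Rightarrow> quat" where
  "qgen i = (if i = 1 then qa else if i = 2 then qb else qa * qb)"

lemmas quat_defs = one_quat_def qa_def qb_def

lemma Quat_decomp: "Quat r0 r1 r2 r3 = qscale r0 1 + qscale r1 qa + qscale r2 qb + qscale r3 (qa * qb)"
  by (simp add: quat_defs)

text \<open>The trace, and the trace after multiplication by the central element \<open>h\<close>.\<close>

fun tr0 :: "quat \<Rightarrow> svar mpoly" where
  "tr0 (Quat r0 r1 r2 r3) = 2 * r0 + x1 * r1 + x2 * r2 + x3 * r3"

fun tr1 :: "quat \<Rightarrow> svar mpoly" where
  "tr1 (Quat r0 r1 r2 r3) = u * r0 + y1 * r1 + y2 * r2 + y3 * r3"

text \<open>The canonical involution of the quaternion algebra. The generators have norm 1, so on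
  them it is the inverse, and it models \<open>winv\<close>.\<close>

definition qconj :: "quat \<Rightarrow> quat" where
  "qconj x = qscale (tr0 x) 1 - x"

lemma tr0_1 [simp]: "tr0 1 = 2" and tr1_1 [simp]: "tr1 1 = u"
  by (simp_all add: one_quat_def)

lemma tr0_add [simp]: "tr0 (x + y) = tr0 x + tr0 y"
  and tr1_add [simp]: "tr1 (x + y) = tr1 x + tr1 y"
  and tr0_diff [simp]: "tr0 (x - y) = tr0 x - tr0 y"
  and tr1_diff [simp]: "tr1 (x - y) = tr1 x - tr1 y"
  by (cases x; cases y; simp add: algebra_simps)+

lemma tr0_qscale [simp]: "tr0 (qscale r x) = r * tr0 x"
  and tr1_qscale [simp]: "tr1 (qscale r x) = r * tr1 x"
  by (cases x; simp add: algebra_simps)+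

lemma tr0_qgen: "i \<in> {1, 2, 3} \<Longrightarrow> tr0 (qgen i) = mvar (xv i)"
  and tr1_qgen: "i \<in> {1, 2, 3} \<Longrightarrow> tr1 (qgen i) = mvar (yv i)"
  by (auto simp: qgen_def quat_defs xv_def yv_def)

lemma tr0_comm: "tr0 (x * y) = tr0 (y * x)"
  by (cases x; cases y) (simp add: algebra_simps)

lemma tr0_mult_qconj: "tr0 (x * qconj y) = tr0 x * tr0 y - tr0 (x * y)"
  and tr1_mult_qconj: "tr1 (x * qconj y) = tr1 x * tr0 y - tr1 (x * y)"
  by (simp_all add: qconj_def qscale_mult_right right_diff_distrib)

lemma qconj_mult: "qconj (x * y) = qconj y * qconj x"
  by (cases x; cases y) (simp add: qconj_def one_quat_def algebra_simps)

lemma qconj_qconj [simp]: "qconj (qconj x) = x"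
  by (simp add: qconj_def)

text \<open>Polarizing the Cayley-Hamilton identity writes \<open>x * y + y * x\<close> through
  \<open>x\<close>, \<open>y\<close> and 1; then \<open>tr1\<close> is applied. This is an identity
  of polynomials, not a congruence.\<close>

lemma tr1_anticomm:
  "tr1 (x * y) + tr1 (y * x) = tr0 y * tr1 x + tr0 x * tr1 y - u * (tr0 x * tr0 y - tr0 (x * y))"
  by (cases x; cases y) (simp add: algebra_simps)

lemma qgen_inverse: "i \<in> {1, 2, 3} \<Longrightarrow> qgen i * qconj (qgen i) = 1"
  and qgen_inverse': "i \<in> {1, 2, 3} \<Longrightarrow> qconj (qgen i) * qgen i = 1"
  by (auto simp: qconj_def qgen_def quat_defs algebra_simps)

lemma qgen_sqr: "i \<in> {1, 2, 3} \<Longrightarrow> qgen i * qgen i = qscale (mvar (xv i)) (qgen i) - 1"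
  by (auto simp: qgen_def quat_defs xv_def)

text \<open>The quadratic equation of a generator turns its powers into a solution of the Chebyshev
  recurrence.\<close>

lemma qgen_power:
  assumes "i \<in> {1, 2, 3}"
  shows "qgen i ^ n = qscale (chebS (int n) (mvar (xv i))) (qgen i)
           - qscale (chebS (int n - 1) (mvar (xv i))) 1"
proof (induction n)
  case 0
  show ?case by (cases "qgen i") (simp add: one_quat_def)
next
  case (Suc n)
  have "qgen i ^ Suc n = qscale (chebS (int n) (mvar (xv i))) (qgen i * qgen i)
           - qscale (chebS (int n - 1) (mvar (xv i))) (qgen i)"
    by (simp add: Suc.IH right_diff_distrib qscale_mult_right)
  also have "\<dots> = qscale (chebS (int n + 1) (mvar (xv i))) (qgen i)
           - qscale (chebS (int n) (mvar (xv i))) 1"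
    unfolding qgen_sqr[OF assms] chebS_rec[of "int n"]
    by (cases "qgen i") (simp add: one_quat_def algebra_simps)
  finally show ?case by (simp add: add.commute)
qed

text \<open>The trace of \<open>x h\<^sup>k\<close>.\<close>

definition trh :: "int \<Rightarrow> quat \<Rightarrow> svar mpoly" where
  "trh k x = chebS k u * tr1 x - chebS (k - 1) u * tr0 x"

lemma trh_0 [simp]: "trh 0 x = tr0 x" and trh_1 [simp]: "trh 1 x = tr1 x"
  by (simp_all add: trh_def)

lemma trh_add [simp]: "trh k (x + y) = trh k x + trh k y"
  and trh_diff [simp]: "trh k (x - y) = trh k x - trh k y"
  and trh_qscale [simp]: "trh k (qscale r x) = r * trh k x"
  by (simp_all add: trh_def algebra_simps)

text \<open>Since \<open>h\<close> is central with trace \<open>u\<close>, the traces against its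
  powers obey the Chebyshev recurrence in \<open>u\<close>; two consecutive exponents determine all
  others.\<close>

lemma trh_shift: "trh (k + l) x = chebS k u * trh (l + 1) x - chebS (k - 1) u * trh l x"
proof -
  have "chebS (k + l - 1) u = chebS k u * chebS l u - chebS (k - 1) u * chebS (l - 1) u"
    using chebS_add[of k "l - 1" u] by (simp add: add_diff_eq)
  then show ?thesis
    by (simp add: trh_def chebS_add[of k l] left_diff_distrib right_diff_distrib mult_ac)
qed

lemma trh_rec: "trh (k + 1) x = u * trh k x - trh (k - 1) x"
proof -
  have "chebS (k - 1 - 1) u = u * chebS (k - 1) u - chebS k u"
    using chebS_rec[of "k - 1" u] by simp
  then show ?thesis
    by (simp add: trh_def chebS_rec[of k] left_diff_distrib right_diff_distrib mult_ac)
qed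

lemma trh_mult_qconj: "trh k (x * qconj y) = trh k x * tr0 y - trh k (x * y)"
  by (simp add: trh_def tr0_mult_qconj tr1_mult_qconj algebra_simps)

text \<open>The trace of \<open>x (h\<^sup>q - c\<^sub>i\<^sup>p) y h\<^sup>k\<close>.\<close>

definition power_defect :: "(nat \<Rightarrow> int) \<Rightarrow> (nat \<Rightarrow> int) \<Rightarrow> nat \<Rightarrow> int \<Rightarrow> quat \<Rightarrow> quat \<Rightarrow> svar mpoly" where
  "power_defect p q i k x y = trh (k + q i) (x * y) - trh k (x * qgen i ^ nat (p i) * y)"

lemma power_defect_cheb:
  assumes "i \<in> {1, 2, 3}" "0 \<le> p i"
  shows "power_defect p q i k x y = trh (k + q i) (x * y)
           - chebS (p i) (mvar (xv i)) * trh k (x * qgen i * y)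
           + chebS (p i - 1) (mvar (xv i)) * trh k (x * y)"
  using assms
  by (simp add: power_defect_def qgen_power right_diff_distrib left_diff_distrib
      qscale_mult_left qscale_mult_right)

text \<open>Both terms of a defect solve the same recurrence in \<open>k\<close>, so the exponents 0
  and 1 suffice.\<close>

lemma power_defect_shift:
  "power_defect p q i k x y =
     chebS k u * power_defect p q i 1 x y - chebS (k - 1) u * power_defect p q i 0 x y"
  using trh_shift[of k 0 "x * qgen i ^ nat (p i) * y"]
  by (simp add: power_defect_def trh_shift[of k "q i"] add.commute[of "q i"]
      right_diff_distrib)

lemma power_defect_linear:
  "power_defect p q i k (Quat r0 r1 r2 r3) 1 =
     r0 * power_defect p q i k 1 1 + r1 * power_defect p q i k qa 1
     + r2 * power_defect p q i k qb 1 + r3 * power_defect p q i k (qa * qb) 1"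
  by (simp add: power_defect_def Quat_decomp distrib_right qscale_mult_left mult.assoc
      del: qscale_Quat plus_quat.simps) (simp add: algebra_simps)

section \<open>The Seifert relations as defects\<close>

context
  fixes p q :: "nat \<Rightarrow> int" and i :: nat
  assumes p: "0 \<le> p i" and i: "i \<in> {1, 2, 3}"
begin

text \<open>Relations (5), (6), (7) and (9) involve one index only: they compare the two sides of
  the power relation paired with \<open>1\<close>, \<open>h\<close>, \<open>c_i\<close> and
  \<open>h c_i\<close>.\<close>

lemma rel5_defect: "chebT (q i) u - chebT (p i) (mvar (xv i)) = power_defect p q i 0 1 1"
  using i by (simp add: power_defect_cheb p chebT_conv_chebS trh_def tr0_qgen algebra_simps)

lemma rel6_defect:
  "chebT (q i + 1) u - chebS (p i) (mvar (xv i)) * mvar (yv i) + chebS (p i - 1) (mvar (xv i)) * u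
     = power_defect p q i 1 1 1"
  unfolding power_defect_cheb[where p = p, OF i p] chebT_conv_chebS
  using tr1_qgen[OF i] by (simp add: trh_def algebra_simps)

lemma rel7_defect:
  "chebS (q i) u * mvar (yv i) - chebS (q i - 1) u * mvar (xv i) - chebT (p i + 1) (mvar (xv i))
     = power_defect p q i 0 (qgen i) 1"
  unfolding power_defect_cheb[where p = p, OF i p] chebT_conv_chebS chebS_rec
  using tr0_qgen[OF i] tr1_qgen[OF i] by (simp add: trh_def qgen_sqr[OF i] algebra_simps)

lemma rel9_defect:
  "chebS (q i + 1) u * mvar (yv i) - chebS (q i) u * mvar (xv i)
     - chebS (p i + 1) (mvar (xv i)) * mvar (yv i) + chebS (p i) (mvar (xv i)) * u
     = power_defect p q i 1 (qgen i) 1"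
  unfolding power_defect_cheb[where p = p, OF i p] chebS_rec[of "p i"]
  using tr0_qgen[OF i] tr1_qgen[OF i] by (simp add: trh_def qgen_sqr[OF i] algebra_simps)

end

context
  fixes p q :: "nat \<Rightarrow> int"
  assumes p: "\<forall>i\<in>{1, 2, 3}. 0 \<le> p i"
begin

text \<open>The second generator stands to the right of \<open>c1\<close> but to the left of
  \<open>c2\<close>, so that the product is already the basis element \<open>a b\<close>. The match
  is then exact and needs no reordering modulo (3).\<close>

lemma rel8_defect:
  "chebS (q 1) u * y2 - chebS (q 1 - 1) u * x2 - chebS (p 1) x1 * x3 + chebS (p 1 - 1) x1 * x2
     = power_defect p q 1 0 1 qb"
  "chebS (q 2) u * y1 - chebS (q 2 - 1) u * x1 - chebS (p 2) x2 * x3 + chebS (p 2 - 1) x2 * x1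
     = power_defect p q 2 0 qa 1"
  using p by (simp_all add: power_defect_cheb trh_def qgen_def quat_defs xv_def algebra_simps)

lemma rel10_defect:
  "chebS (q 1) u * y3 - chebS (q 1 - 1) u * x3 - chebS (p 1 + 1) x1 * x3 + chebS (p 1) x1 * x2
     = power_defect p q 1 0 1 (qa * qb)"
  "chebS (q 2) u * y3 - chebS (q 2 - 1) u * x3 - chebS (p 2 + 1) x2 * x3 + chebS (p 2) x2 * x1
     = power_defect p q 2 0 (qa * qb) 1"
  "chebS (q 3) u * y2 - chebS (q 3 - 1) u * x2 - chebS (p 3 + 1) x3 * x2 + chebS (p 3) x3 * x1
     = power_defect p q 3 0 1 qb"
  "chebS (q 3) u * y1 - chebS (q 3 - 1) u * x1 - chebS (p 3 + 1) x3 * x1 + chebS (p 3) x3 * x2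
     = power_defect p q 3 0 qa 1"
  unfolding chebS_rec[of "p 1"] chebS_rec[of "p 2"] chebS_rec[of "p 3"] using p
  by (simp_all add: power_defect_cheb trh_def qgen_def quat_defs xv_def algebra_simps)

lemma rel11_defect:
  "chebS (q 1 + 1) u * y2 - chebS (q 1) u * x2 - chebS (p 1) x1 * y3 + chebS (p 1 - 1) x1 * y2
     = power_defect p q 1 1 1 qb"
  "chebS (q 2 + 1) u * y1 - chebS (q 2) u * x1 - chebS (p 2) x2 * y3 + chebS (p 2 - 1) x2 * y1
     = power_defect p q 2 1 qa 1"
  using p by (simp_all add: power_defect_cheb trh_def qgen_def quat_defs xv_def algebra_simps)

lemma rel12_defect:
  "chebS (q 3 + 1) u * y1 - chebS (q 3) u * x1 - chebS (p 3) x3 * (x1 * y3 - y2) + chebS (p 3 - 1) x3 * y1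
     = power_defect p q 3 1 qa 1"
  "chebS (q 3 + 1) u * y2 - chebS (q 3) u * x2 - chebS (p 3) x3 * (x2 * y3 - y1) + chebS (p 3 - 1) x3 * y2
     = power_defect p q 3 1 1 qb"
  using p by (simp_all add: power_defect_cheb trh_def qgen_def quat_defs xv_def algebra_simps)

end

section \<open>Traces of words\<close>

text \<open>The central letter goes to 1 because its exponent is recorded separately by
  \<open>letter_exp\<close>.\<close>

fun letter_quat :: "gen \<times> bool \<Rightarrow> quat" where
  "letter_quat (Gh, b) = 1"
| "letter_quat (Gc1, b) = (if b then qconj qa else qa)"
| "letter_quat (Gc2, b) = (if b then qconj qb else qb)"

fun letter_exp :: "gen \<times> bool \<Rightarrow> int" where
  "letter_exp (Gh, b) = (if b then - 1 else 1)"
| "letter_exp (Gc1, b) = 0"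
| "letter_exp (Gc2, b) = 0"

definition word_quat :: "word \<Rightarrow> quat" where
  "word_quat w = prod_list (map letter_quat w)"

definition word_exp :: "word \<Rightarrow> int" where
  "word_exp w = sum_list (map letter_exp w)"

definition word_trace :: "word \<Rightarrow> svar mpoly" where
  "word_trace w = trh (word_exp w) (word_quat w)"

lemma word_quat_Nil [simp]: "word_quat [] = 1"
  and word_quat_Cons: "word_quat (l # w) = letter_quat l * word_quat w"
  and word_quat_append [simp]: "word_quat (v @ w) = word_quat v * word_quat w"
  and word_exp_Nil [simp]: "word_exp [] = 0"
  and word_exp_Cons: "word_exp (l # w) = letter_exp l + word_exp w"
  and word_exp_append [simp]: "word_exp (v @ w) = word_exp v + word_exp w"
  by (simp_all add: word_quat_def word_exp_def)

lemma qconj_1 [simp]: "qconj 1 = 1"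
  by (simp add: qconj_def one_quat_def)

lemma letter_quat_inverse: "letter_quat (g, b) * letter_quat (g, \<not> b) = 1"
  using qgen_inverse[of 1] qgen_inverse[of 2] qgen_inverse'[of 1] qgen_inverse'[of 2]
  by (cases g) (auto simp: qgen_def)

lemma letter_quat_not: "letter_quat (g, \<not> b) = qconj (letter_quat (g, b))"
  by (cases g) auto

lemma letter_exp_not: "letter_exp (g, \<not> b) = - letter_exp (g, b)"
  by (cases g) auto

lemma winv_Nil [simp]: "winv [] = []"
  and winv_Cons: "winv ((g, b) # w) = winv w @ [(g, \<not> b)]"
  by (simp_all add: winv_def)

lemma word_quat_winv [simp]: "word_quat (winv w) = qconj (word_quat w)"
proof (induction w)
  case (Cons l w)
  then show ?case
    by (cases l) (simp add: winv_Cons word_quat_Cons qconj_mult letter_quat_not del: letter_quat.simps)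
qed simp

lemma word_exp_winv [simp]: "word_exp (winv w) = - word_exp w"
proof (induction w)
  case (Cons l w)
  then show ?case
    by (cases l) (simp add: winv_Cons word_exp_Cons letter_exp_not del: letter_exp.simps)
qed simp

lemma word_quat_concat_replicate: "word_quat (concat (replicate n w)) = word_quat w ^ n"
  by (induction n) simp_all

lemma word_exp_concat_replicate: "word_exp (concat (replicate n w)) = int n * word_exp w"
  by (induction n) (simp_all add: algebra_simps)

lemma word_quat_wh [simp]: "word_quat wh = 1" and word_exp_wh [simp]: "word_exp wh = 1"
  by (simp_all add: wh_def word_quat_def word_exp_def)

lemma word_quat_wpow_wh [simp]: "word_quat (wpow wh k) = 1"
  by (simp add: wpow_def word_quat_concat_replicate)

lemma word_exp_wpow_wh [simp]: "word_exp (wpow wh k) = k"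
  by (simp add: wpow_def word_exp_concat_replicate)

lemma word_quat_wc1 [simp]: "word_quat wc1 = qa" and word_exp_wc1 [simp]: "word_exp wc1 = 0"
  and word_quat_wc2 [simp]: "word_quat wc2 = qb" and word_exp_wc2 [simp]: "word_exp wc2 = 0"
  by (simp_all add: wc1_def wc2_def word_quat_def word_exp_def)

lemma word_quat_wc [simp]: "word_quat (wc i) = qgen i"
  and word_exp_wc [simp]: "word_exp (wc i) = 0"
  by (simp_all add: wc_def qgen_def)

lemma word_quat_wpow_wc: "0 \<le> n \<Longrightarrow> word_quat (wpow (wc i) n) = qgen i ^ nat n"
  by (simp add: wpow_def word_quat_concat_replicate)

lemma word_exp_wpow_wc [simp]: "word_exp (wpow (wc i) n) = 0"
  by (simp add: wpow_def word_exp_concat_replicate)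

text \<open>Being an equality of polynomials, this makes substitution of \<open>word_trace\<close>
  an exact left inverse of \<open>trace_map\<close>.\<close>

lemma word_trace_svar_word: "word_trace (svar_word v) = mvar v"
  by (cases v) (simp_all add: word_trace_def svar_word_def qgen_def quat_defs)

text \<open>Translates a power relation in an arbitrary context into a defect; both directions of
  the proof use it.\<close>

lemma word_trace_rel_c:
  assumes "0 \<le> p i"
  shows "word_trace (v @ wpow wh (q i) @ w) - word_trace (v @ wpow (wc i) (p i) @ w)
           = power_defect p q i (word_exp v + word_exp w) (word_quat v) (word_quat w)"
  using assms
  by (simp add: word_trace_def power_defect_def word_quat_wpow_wc add_ac mult.assoc)

section \<open>The trace function satisfies the relations of the character ring\<close>

context
  fixes p q :: "nat \<Rightarrow> int"
  assumes p: "\<forall>i\<in>{1, 2, 3}. 2 \<le> p i"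
begin

abbreviation (input) in_I :: "svar mpoly \<Rightarrow> bool" where
  "in_I f \<equiv> f \<in> ideal_gen (seifert_rels p q)"

lemma p_nonneg: "i \<in> {1, 2, 3} \<Longrightarrow> 0 \<le> p i"
  using p by fastforce

lemma p_nonneg': "\<forall>i\<in>{1, 2, 3}. 0 \<le> p i"
  using p by fastforce

text \<open>Polarized identities only yield twice the wanted element; 2 can be cancelled because the
  coefficients are complex numbers.\<close>

lemma in_I_half: "in_I (2 * f) \<Longrightarrow> in_I f"
proof -
  assume "in_I (2 * f)"
  then have "in_I (mconst (1 / 2) * (2 * f))"
    by (rule ideal_gen_mult_left)
  moreover have "mconst (1 / 2) * (2 :: svar mpoly) = 1"
    using mconst_mult[of "1 / 2" 2] by (simp add: mconst_numeral)
  then have "mconst (1 / 2) * (2 * f) = f"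
    by (simp flip: mult.assoc)
  ultimately show ?thesis by simp
qed

lemma rel1:
  "in_I (u^2 + x1^2 + y1^2 - u * x1 * y1 - 4)"
  "in_I (u^2 + x2^2 + y2^2 - u * x2 * y2 - 4)"
  "in_I (u^2 + x3^2 + y3^2 - u * x3 * y3 - 4)"
proof -
  have "in_I (u^2 + (mvar (xv i))^2 + (mvar (yv i))^2 - u * mvar (xv i) * mvar (yv i) - 4)"
    if "i \<in> {1, 2, 3}" for i
    by (rule ideal_gen_base) (use that in \<open>unfold seifert_rels_def Let_def, blast\<close>)
  from this[of 1] this[of 2] this[of 3] show
    "in_I (u^2 + x1^2 + y1^2 - u * x1 * y1 - 4)"
    "in_I (u^2 + x2^2 + y2^2 - u * x2 * y2 - 4)"
    "in_I (u^2 + x3^2 + y3^2 - u * x3 * y3 - 4)"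
    by (simp_all add: xv_def yv_def)
qed

lemma rel2:
  "in_I (2 * y1 - (u * x1 + x2 * y3 - x3 * y2))"
  "in_I (2 * y2 - (u * x2 + x1 * y3 - x3 * y1))"
proof -
  have "in_I (2 * mvar (yv i) - (u * mvar (xv i) + mvar (xv j) * mvar (yv 3) - mvar (xv 3) * mvar (yv j)))"
    if "(i, j) \<in> {(1, 2), (2, 1)}" for i j
    by (rule ideal_gen_base) (use that in \<open>unfold seifert_rels_def Let_def, blast\<close>)
  from this[of 1 2] this[of 2 1] show
    "in_I (2 * y1 - (u * x1 + x2 * y3 - x3 * y2))"
    "in_I (2 * y2 - (u * x2 + x1 * y3 - x3 * y1))"
    by (simp_all add: xv_def yv_def)
qed

lemma rel3: "in_I (2 * y3 - (u * (x3 - x1 * x2) + y1 * x2 + y2 * x1))"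
  by (rule ideal_gen_base) (simp add: seifert_rels_def Let_def xv_def yv_def)

lemma rel4: "in_I (2 * x3 - (u * y3 + x1 * x2 - y1 * y2))"
  by (rule ideal_gen_base) (simp add: seifert_rels_def Let_def xv_def yv_def)

lemma tr1_comm: "in_I (tr1 (x * y) - tr1 (y * x))"
proof (cases x; cases y)
  fix r0 r1 r2 r3 s0 s1 s2 s3
  assume xy: "x = Quat r0 r1 r2 r3" "y = Quat s0 s1 s2 s3"
  \<comment> \<open>The difference is alternating and bilinear, so the coefficients are 2 by 2
    minors. The three relations are, up to sign, the values of \<open>tr1\<close> on the commutators
    of \<open>a, b\<close>, of \<open>a, a b\<close> and of \<open>b, a b\<close>.\<close>
  have "tr1 (x * y) - tr1 (y * x) =
      (r1 * s2 - r2 * s1) * (2 * y3 - (u * (x3 - x1 * x2) + y1 * x2 + y2 * x1))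
    - (r1 * s3 - r3 * s1) * (2 * y2 - (u * x2 + x1 * y3 - x3 * y1))
    + (r2 * s3 - r3 * s2) * (2 * y1 - (u * x1 + x2 * y3 - x3 * y2))"
    by (simp add: xy algebra_simps)
  then show ?thesis
    by simp (rule rel2 rel3 | rule ideal_gen_rules)+
qed

lemma trh_comm: "in_I (trh k (x * y) - trh k (y * x))"
proof -
  have "trh k (x * y) - trh k (y * x) = chebS k u * (tr1 (x * y) - tr1 (y * x))"
    using tr0_comm[of x y] by (simp add: trh_def algebra_simps)
  then show ?thesis using tr1_comm by (simp add: ideal_gen_mult_left)
qed

text \<open>Relation (4) with \<open>(c\<^sub>1, c\<^sub>2)\<close> replaced by \<open>(c\<^sub>1\<^sup>-\<^sup>1, c\<^sub>3)\<close> and \<open>(c\<^sub>3, c\<^sub>2\<^sup>-\<^sup>1)\<close>.\<close>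

lemma rel4_variants:
  "in_I (u * (x1 * y3 - y2) - x1 * x3 + 2 * x2 - y1 * y3)"
  "in_I (u * (x2 * y3 - y1) - x2 * x3 + 2 * x1 - y2 * y3)"
proof -
  have "2 * (u * (x1 * y3 - y2) - x1 * x3 + 2 * x2 - y1 * y3) =
     - x1 * (2 * x3 - (u * y3 + x1 * x2 - y1 * y2))
     - y1 * (2 * y3 - (u * (x3 - x1 * x2) + y1 * x2 + y2 * x1))
     - u * (2 * y2 - (u * x2 + x1 * y3 - x3 * y1))
     - x2 * (u^2 + x1^2 + y1^2 - u * x1 * y1 - 4)"
    by (simp add: algebra_simps power2_eq_square)
  moreover have "in_I \<dots>"
    by (rule rel1 rel2 rel3 rel4 | rule ideal_gen_rules)+
  ultimately show "in_I (u * (x1 * y3 - y2) - x1 * x3 + 2 * x2 - y1 * y3)"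
    by (metis in_I_half)
  have "2 * (u * (x2 * y3 - y1) - x2 * x3 + 2 * x1 - y2 * y3) =
     - x2 * (2 * x3 - (u * y3 + x1 * x2 - y1 * y2))
     - y2 * (2 * y3 - (u * (x3 - x1 * x2) + y1 * x2 + y2 * x1))
     - u * (2 * y1 - (u * x1 + x2 * y3 - x3 * y2))
     - x1 * (u^2 + x2^2 + y2^2 - u * x2 * y2 - 4)"
    by (simp add: algebra_simps power2_eq_square)
  moreover have "in_I \<dots>"
    by (rule rel1 rel2 rel3 rel4 | rule ideal_gen_rules)+
  ultimately show "in_I (u * (x2 * y3 - y1) - x2 * x3 + 2 * x1 - y2 * y3)"
    by (metis in_I_half)
qed

text \<open>The trace relation for \<open>h x\<close> and \<open>h y\<close>, as
  \<open>h^2 x y\<close> has trace \<open>u * tr1 (x * y) - tr0 (x * y)\<close>. By bilinearity,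
  equal basis elements give (1), distinct ones give (4) or a variant, and multiples of (2) and (3)
  correct the order of factors; pairs containing 1 cancel.\<close>

lemma tr1_tr1: "in_I (u * tr1 (x * y) - tr0 (x * y) + tr0 (x * qconj y) - tr1 x * tr1 y)"
proof (cases x; cases y)
  fix r0 r1 r2 r3 s0 s1 s2 s3
  assume xy: "x = Quat r0 r1 r2 r3" "y = Quat s0 s1 s2 s3"
  have "u * tr1 (x * y) - tr0 (x * y) + tr0 (x * qconj y) - tr1 x * tr1 y =
      - (r1 * s1) * (u^2 + x1^2 + y1^2 - u * x1 * y1 - 4)
      - (r2 * s2) * (u^2 + x2^2 + y2^2 - u * x2 * y2 - 4)
      - (r3 * s3) * (u^2 + x3^2 + y3^2 - u * x3 * y3 - 4)
      - (r1 * s2 + r2 * s1) * (2 * x3 - (u * y3 + x1 * x2 - y1 * y2))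
      - (r2 * s1) * u * (2 * y3 - (u * (x3 - x1 * x2) + y1 * x2 + y2 * x1))
      + (r1 * s3 + r3 * s1) * (u * (x1 * y3 - y2) - x1 * x3 + 2 * x2 - y1 * y3)
      + (r3 * s1) * u * (2 * y2 - (u * x2 + x1 * y3 - x3 * y1))
      + (r2 * s3 + r3 * s2) * (u * (x2 * y3 - y1) - x2 * x3 + 2 * x1 - y2 * y3)
      + (r2 * s3) * u * (2 * y1 - (u * x1 + x2 * y3 - x3 * y2))"
    unfolding tr0_mult_qconj by (simp add: xy algebra_simps power2_eq_square)
  moreover have "in_I \<dots>"
    by (rule rel1 rel2 rel3 rel4 rel4_variants | rule ideal_gen_rules)+
  ultimately show ?thesis by simp
qed

lemma trh_trace_identity:
  "in_I (trh (k + l) (x * y) + trh (k - l) (x * qconj y) - trh k x * trh l y)"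
proof -
  define \<alpha> \<beta> \<gamma> \<delta> where "\<alpha> = chebS k u" "\<beta> = chebS (k - 1) u" "\<gamma> = chebS l u" "\<delta> = chebS (l - 1) u"
  note defs = this
  have l1: "chebS (l + 1) u = u * \<gamma> - \<delta>"
    by (simp add: chebS_rec defs)
  have plus: "chebS (k + l) u = u * \<alpha> * \<gamma> - \<alpha> * \<delta> - \<beta> * \<gamma>"
    unfolding chebS_add[of k l] l1 by (simp add: defs algebra_simps)
  have plus1: "chebS (k + l - 1) u = \<alpha> * \<gamma> - \<beta> * \<delta>"
    using chebS_add[of k "l - 1" u] by (simp add: add_diff_eq defs)
  have "1 - l = - (l - 1)" by simp
  then have minus: "chebS (k - l) u = \<beta> * \<gamma> - \<alpha> * \<delta>"
    using chebS_add[of k "- l" u] chebS_minus[of "l - 1" u] chebS_minus[of l u]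
    by (simp add: defs)
  have e: "k + - (l + 1) = k - l - 1" "- (l + 1) + 1 = - l" by simp_all
  have minus1: "chebS (k - l - 1) u = u * \<beta> * \<gamma> - \<beta> * \<delta> - \<alpha> * \<gamma>"
    using chebS_add[of k "- (l + 1)" u, unfolded e chebS_minus l1]
    by (simp add: defs algebra_simps)
  have yx: "tr1 (y * x) =
      tr0 y * tr1 x + tr0 x * tr1 y - u * (tr0 x * tr0 y - tr0 (x * y)) - tr1 (x * y)"
    using tr1_anticomm[of x y] by (simp add: algebra_simps)
  \<comment> \<open>The coefficients of \<alpha> * \<delta> and \<beta> * \<delta> cancel
    identically. That of \<alpha> * \<gamma> is the case \<open>k = l = 1\<close>, and that of
    \<beta> * \<gamma> becomes a commutator by \<open>tr1_anticomm\<close>.\<close>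
  have "trh (k + l) (x * y) + trh (k - l) (x * qconj y) - trh k x * trh l y =
      \<alpha> * \<gamma> * (u * tr1 (x * y) - tr0 (x * y) + tr0 (x * qconj y) - tr1 x * tr1 y)
      - \<beta> * \<gamma> * (tr1 (x * y) - tr1 (y * x))"
    unfolding trh_def plus plus1 minus minus1 yx tr0_mult_qconj tr1_mult_qconj defs[symmetric]
    by (simp add: algebra_simps)
  moreover have "in_I \<dots>"
    by (rule tr1_tr1 tr1_comm | rule ideal_gen_rules)+
  ultimately show ?thesis by simp
qed

text \<open>The case \<open>l = 1\<close> of the trace identity with the conjugate and the exponent
  \<open>k - 1\<close> eliminated. It reduces the trace of \<open>x y\<close> at exponent
  \<open>k + 1\<close> to exponent \<open>k\<close>, linearly in \<open>x\<close>.\<close>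

lemma trh_polarized:
  "in_I (2 * trh (k + 1) (x * y)
     - (trh (k + 1) x * tr0 y + trh k x * tr1 y - u * (trh k x * tr0 y - trh k (x * y))))"
proof -
  have "u * trh k (x * qconj y) = trh (k + 1) (x * qconj y) + trh (k - 1) (x * qconj y)"
    by (simp add: trh_rec)
  then have eq: "2 * trh (k + 1) (x * y)
     - (trh (k + 1) x * tr0 y + trh k x * tr1 y - u * (trh k x * tr0 y - trh k (x * y)))
     = trh (k + 1) (x * y) + trh (k - 1) (x * qconj y) - trh k x * trh 1 y"
    unfolding trh_mult_qconj[of k] trh_mult_qconj[of "k + 1"] by (simp add: algebra_simps)
  show ?thesis unfolding eq using trh_trace_identity[of k 1 x y] by simp
qed

section \<open>Vanishing of the power defects modulo the Seifert ideal\<close>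

lemma power_defect_cyclic: "in_I (power_defect p q i k x y) \<longleftrightarrow> in_I (power_defect p q i k (y * x) 1)"
proof (rule ideal_cong_mem_iff, unfold ideal_cong_def)
  have "power_defect p q i k x y - power_defect p q i k (y * x) 1 =
      (trh (k + q i) (x * y) - trh (k + q i) (y * x))
    - (trh k ((x * qgen i ^ nat (p i)) * y) - trh k (y * (x * qgen i ^ nat (p i))))"
    by (simp add: power_defect_def mult.assoc)
  also have "in_I \<dots>"
    by (intro ideal_gen_diff trh_comm)
  finally show "in_I (power_defect p q i k x y - power_defect p q i k (y * x) 1)" .
qed

text \<open>The polarized formula is linear in its first argument, so subtracting its instances for
  \<open>w h^q\<close> and \<open>w c_i^p\<close> expresses twice the defect at exponent 1 through
  the three given ones.\<close>

lemma power_defect_lift: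
  assumes "in_I (power_defect p q i 0 w 1)" "in_I (power_defect p q i 1 w 1)"
    and "in_I (power_defect p q i 0 w y)"
  shows "in_I (power_defect p q i 1 w y)"
proof (rule in_I_half)
  define v where "v = w * qgen i ^ nat (p i)"
  \<comment> \<open>The error term of \<open>trh_polarized\<close>: \<open>P (q i) w\<close> belongs
    to \<open>w h^q\<close>, and \<open>P 0 v\<close> to \<open>w c_i^p\<close>.\<close>
  define P where "P = (\<lambda>k x. 2 * trh (k + 1) (x * y)
     - (trh (k + 1) x * tr0 y + trh k x * tr1 y - u * (trh k x * tr0 y - trh k (x * y))))"
  have "2 * power_defect p q i 1 w y = P (q i) w - P 0 v
      + tr0 y * power_defect p q i 1 w 1 + (tr1 y - u * tr0 y) * power_defect p q i 0 w 1
      + u * power_defect p q i 0 w y"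
    by (simp add: power_defect_def P_def v_def algebra_simps)
  also have "in_I \<dots>"
    unfolding P_def by (rule trh_polarized assms | rule ideal_gen_rules)+
  finally show "in_I (2 * power_defect p q i 1 w y)" .
qed

lemma power_defect_commute:
  "power_defect p q i k (qgen i) y = power_defect p q i k 1 (qgen i * y)"
  by (simp add: power_defect_def power_commutes flip: mult.assoc)

lemma power_defect_basic:
  assumes i: "i \<in> {1, 2, 3}"
  shows "in_I (power_defect p q i 0 1 1)" "in_I (power_defect p q i 1 1 1)"
    "in_I (power_defect p q i 0 (qgen i) 1)" "in_I (power_defect p q i 1 (qgen i) 1)"
proof -
  note rels = rel5_defect rel6_defect rel7_defect rel9_defect
  show "in_I (power_defect p q i 0 1 1)" "in_I (power_defect p q i 1 1 1)"
    "in_I (power_defect p q i 0 (qgen i) 1)" "in_I (power_defect p q i 1 (qgen i) 1)"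
    unfolding rels[where p = p, OF p_nonneg[OF i] i, symmetric]
    by (rule ideal_gen_base; use i in \<open>unfold seifert_rels_def Let_def, blast\<close>)+
qed

lemma power_defect_mixed:
  "in_I (power_defect p q 1 0 1 qb)" "in_I (power_defect p q 1 1 1 qb)"
  "in_I (power_defect p q 2 0 qa 1)" "in_I (power_defect p q 2 1 qa 1)"
  "in_I (power_defect p q 1 0 1 (qa * qb))" "in_I (power_defect p q 2 0 (qa * qb) 1)"
  "in_I (power_defect p q 3 0 qa 1)" "in_I (power_defect p q 3 0 1 qb)"
  "in_I (power_defect p q 3 1 qa 1)" "in_I (power_defect p q 3 1 1 qb)"
proof -
  have r8: "in_I (chebS (q i) u * mvar (yv j) - chebS (q i - 1) u * mvar (xv j)
      - chebS (p i) (mvar (xv i)) * mvar (xv 3) + chebS (p i - 1) (mvar (xv i)) * mvar (xv j))"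
    if "(i, j) \<in> {(1, 2), (2, 1)}" for i j
    by (rule ideal_gen_base) (use that in \<open>unfold seifert_rels_def Let_def, blast\<close>)
  have r10: "in_I (chebS (q i) u * mvar (yv k) - chebS (q i - 1) u * mvar (xv k)
      - chebS (p i + 1) (mvar (xv i)) * mvar (xv k) + chebS (p i) (mvar (xv i)) * mvar (xv j))"
    if "i \<in> {1, 2, 3} \<and> j \<in> {1, 2, 3} \<and> k \<in> {1, 2, 3} \<and> i \<noteq> j \<and> j \<noteq> k \<and> i \<noteq> k \<and> j \<noteq> 3" for i j k
    by (rule ideal_gen_base) (use that in \<open>unfold seifert_rels_def Let_def, blast\<close>)
  have r11: "in_I (chebS (q i + 1) u * mvar (yv j) - chebS (q i) u * mvar (xv j)
      - chebS (p i) (mvar (xv i)) * mvar (yv 3) + chebS (p i - 1) (mvar (xv i)) * mvar (yv j))"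
    if "(i, j) \<in> {(1, 2), (2, 1)}" for i j
    by (rule ideal_gen_base) (use that in \<open>unfold seifert_rels_def Let_def, blast\<close>)
  have r12: "in_I (chebS (q 3 + 1) u * mvar (yv i) - chebS (q 3) u * mvar (xv i)
      - chebS (p 3) (mvar (xv 3)) * (mvar (xv i) * mvar (yv 3) - mvar (yv j))
      + chebS (p 3 - 1) (mvar (xv 3)) * mvar (yv i))"
    if "(i, j) \<in> {(1, 2), (2, 1)}" for i j
    by (rule ideal_gen_base) (use that in \<open>unfold seifert_rels_def Let_def, blast\<close>)
  note rels = rel8_defect rel10_defect rel11_defect rel12_defect
  note rels = rels[where p = p, OF p_nonneg', symmetric]
  show "in_I (power_defect p q 1 0 1 qb)" "in_I (power_defect p q 2 0 qa 1)"
    unfolding rels using r8[of 1 2] r8[of 2 1] by (simp_all add: xv_def yv_def)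
  show "in_I (power_defect p q 1 0 1 (qa * qb))" "in_I (power_defect p q 2 0 (qa * qb) 1)"
    "in_I (power_defect p q 3 0 qa 1)" "in_I (power_defect p q 3 0 1 qb)"
    unfolding rels using r10[of 1 2 3] r10[of 2 1 3] r10[of 3 2 1] r10[of 3 1 2]
    by (simp_all add: xv_def yv_def)
  show "in_I (power_defect p q 1 1 1 qb)" "in_I (power_defect p q 2 1 qa 1)"
    unfolding rels using r11[of 1 2] r11[of 2 1] by (simp_all add: xv_def yv_def)
  show "in_I (power_defect p q 3 1 qa 1)" "in_I (power_defect p q 3 1 1 qb)"
    unfolding rels using r12[of 1 2] r12[of 2 1] by (simp_all add: xv_def yv_def)
qed

text \<open>The list of relations omits the defects of \<open>c\<^sub>1 c\<^sub>2\<close> against \<open>h\<close> for \<open>i = 1, 2\<close>;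
  they come from the others by polarization.\<close>

lemma power_defect_basis:
  assumes i: "i \<in> {1, 2, 3}" and k: "k \<in> {0, 1}" and e: "e \<in> {1, qa, qb, qa * qb}"
  shows "in_I (power_defect p q i k e 1)"
proof -
  have g: "qgen 1 = qa" "qgen 2 = qb" "qgen 3 = qa * qb"
    by (simp_all add: qgen_def)
  note basic1 = power_defect_basic[of 1, unfolded g, OF insertI1]
  note basic2 = power_defect_basic[of 2, unfolded g, simplified]
  note basic3 = power_defect_basic[of 3, unfolded g, simplified]
  \<comment> \<open>Relation (10) gives the defect at \<open>1, a b\<close>. As \<open>a\<close>
    commutes with its own power, this is the defect at \<open>a, b\<close>, the form needed for
    lifting with \<open>w = a\<close>.\<close>
  have "in_I (power_defect p q 1 0 qa qb)"
    using power_defect_mixed(5) power_defect_commute[of 1 0 qb, unfolded g] by simp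
  from power_defect_lift[OF basic1(3,4) this]
  have ab1: "in_I (power_defect p q 1 1 1 (qa * qb))"
    using power_defect_commute[of 1 1 qb, unfolded g] by simp
  \<comment> \<open>For \<open>i = 2\<close> the left factor has to be \<open>b\<close>, so
    cyclicity turns \<open>a b, 1\<close> into \<open>b, a\<close> before lifting and back
    afterwards.\<close>
  have "in_I (power_defect p q 2 0 qb qa)"
    using power_defect_mixed(6) by (subst power_defect_cyclic)
  from power_defect_lift[OF basic2(3,4) this]
  have ab2: "in_I (power_defect p q 2 1 (qa * qb) 1)"
    by (subst (asm) power_defect_cyclic)
  note cyc = power_defect_cyclic[of _ _ 1, simplified]
  show ?thesis
    using i k e basic1 basic2 basic3 ab2 power_defect_mixed(3,4,6,7,9)
      ab1[unfolded cyc] power_defect_mixed(1,2,5,8,10)[unfolded cyc]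
    by auto
qed

text \<open>Cyclicity makes the right argument 1, the recurrence in \<open>k\<close> leaves the
  exponents 0 and 1, and linearity leaves the four basis elements.\<close>

lemma power_defect_mem:
  assumes i: "i \<in> {1, 2, 3}"
  shows "in_I (power_defect p q i k x y)"
proof -
  have "in_I (power_defect p q i k' z 1)" if "k' \<in> {0, 1}" for k' z
  proof (cases z)
    case (Quat r0 r1 r2 r3)
    show ?thesis
      unfolding Quat power_defect_linear
      by (intro ideal_gen.add ideal_gen_mult_left power_defect_basis i that) auto
  qed
  then have "in_I (power_defect p q i k (y * x) 1)"
    by (subst power_defect_shift) (intro ideal_gen_diff ideal_gen_mult_left, auto)
  then show ?thesis by (subst power_defect_cyclic)
qed

text \<open>The contexts \<open>l\<close> and \<open>r\<close> let the induction pass the congruence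
  rule. Free cancellation and commutation with \<open>h\<close> preserve \<open>word_trace\<close>
  exactly; the power relations do so only modulo the ideal.\<close>

lemma word_trace_pi1_eq:
  "pi1_eq p q v w \<Longrightarrow> in_I (word_trace (l @ v @ r) - word_trace (l @ w @ r))"
proof (induction arbitrary: l r rule: pi1_eq.induct)
  case (refl w)
  show ?case by (simp add: ideal_gen.zero)
next
  case (sym v w)
  then show ?case using ideal_gen_uminus by fastforce
next
  case (trans u v w)
  then show ?case
    using ideal_gen.add[OF trans.IH(1)[of l r] trans.IH(2)[of l r]] by simp
next
  case (cong v w a b)
  show ?case using cong.IH[of "l @ a" "b @ r"] by simp
next
  case (cancel g b)
  have "word_trace (l @ [(g, b), (g, \<not> b)] @ r) = word_trace (l @ [] @ r)"
    unfolding word_trace_def word_quat_append word_exp_append word_quat_Cons word_exp_Cons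
      letter_exp_not
    using letter_quat_inverse[of g b] by (simp flip: mult.assoc)
  then show ?case by (simp add: ideal_gen.zero)
next
  case rel_h1
  show ?case by (simp add: word_trace_def ideal_gen.zero)
next
  case rel_h2
  show ?case by (simp add: word_trace_def ideal_gen.zero)
next
  case (rel_c i)
  have "word_trace (l @ wpow wh (q i) @ r) - word_trace (l @ wpow (wc i) (p i) @ r)
      = power_defect p q i (word_exp l + word_exp r) (word_quat l) (word_quat r)"
    using p_nonneg[OF rel_c] by (rule word_trace_rel_c)
  then show ?case
    using power_defect_mem[OF rel_c] ideal_gen_uminus by (metis minus_diff_eq)
qed

text \<open>Hence substituting \<open>word_trace\<close> descends to a map from the character ring
  to the Seifert quotient.\<close>

lemma word_trace_char_rels:
  assumes "s \<in> char_rels p q"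
  shows "in_I (msubst word_trace s)"
proof -
  consider (eq) v w where "pi1_eq p q v w" "s = mvar v - mvar w"
    | (tr) a b where "s = mvar (a @ b) + mvar (a @ winv b) - mvar a * mvar b"
    | (cyc) a b where "s = mvar (a @ b) - mvar (b @ a)"
    | (one) "s = mvar [] - 2"
    using assms unfolding char_rels_def by blast
  then show ?thesis
  proof cases
    case eq
    then show ?thesis using word_trace_pi1_eq[OF eq(1), of "[]" "[]"] by simp
  next
    case (tr a b)
    then show ?thesis
      using trh_trace_identity[of "word_exp a" "word_exp b" "word_quat a" "word_quat b"]
      by (simp add: word_trace_def)
  next
    case (cyc a b)
    then show ?thesis
      using trh_comm[of "word_exp a + word_exp b" "word_quat a" "word_quat b"]
      by (simp add: word_trace_def add.commute)
  next
    case one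
    then show ?thesis by (simp add: word_trace_def ideal_gen.zero)
  qed
qed

end

section \<open>Expansion of words in the character ring\<close>

context
  fixes p q :: "nat \<Rightarrow> int"
begin

abbreviation (input) t :: "word \<Rightarrow> word mpoly" where
  "t \<equiv> mvar"

abbreviation (input) J_cong :: "word mpoly \<Rightarrow> word mpoly \<Rightarrow> bool"  (infix \<open>\<approx>\<close> 50) where
  "f \<approx> g \<equiv> ideal_cong (char_rels p q) f g"

lemma t_pi1_eq: "pi1_eq p q v w \<Longrightarrow> t v \<approx> t w"
  unfolding ideal_cong_def by (rule ideal_gen_base) (auto simp: char_rels_def)

lemma t_comm: "t (v @ w) \<approx> t (w @ v)"
  unfolding ideal_cong_def by (rule ideal_gen_base) (auto simp: char_rels_def)

lemma t_mult: "t (v @ w) + t (v @ winv w) \<approx> t v * t w"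
  unfolding ideal_cong_def by (rule ideal_gen_base) (auto simp: char_rels_def)

lemma t_Nil: "t [] \<approx> 2"
  unfolding ideal_cong_def by (rule ideal_gen_base) (auto simp: char_rels_def)

text \<open>Cyclicity rotates \<open>g\<close> to the end, where the trace relation applies. This
  serves as the Cayley-Hamilton rule \<open>g = t(g) - g^-1\<close> inside any word.\<close>

lemma t_insert: "t (v @ g @ w) \<approx> t g * t (v @ w) - t (v @ winv g @ w)"
proof -
  have cyc: "t (v @ x @ w) \<approx> t ((w @ v) @ x)" for x
    using t_comm[of "v @ x" w] by simp
  have "t (v @ g @ w) + t (v @ winv g @ w) \<approx> t ((w @ v) @ g) + t ((w @ v) @ winv g)"
    by (intro ideal_cong_add cyc)
  also have "\<dots> \<approx> t (w @ v) * t g"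
    by (rule t_mult)
  also have "\<dots> \<approx> t (v @ w) * t g"
    by (intro ideal_cong_mult t_comm ideal_cong_refl)
  finally show ?thesis
    by (simp add: ideal_cong_def algebra_simps)
qed

lemma t_insert_winv: "t (v @ winv g @ w) \<approx> t g * t (v @ w) - t (v @ g @ w)"
  using t_insert[of v g w] by (simp add: ideal_cong_def algebra_simps)

lemma pi1_cancel_context: "pi1_eq p q (l @ [(g, b), (g, \<not> b)] @ r) (l @ r)"
  using pi1_eq.cong[OF pi1_eq.cancel, of p q l g b r] by simp

lemma wh_letter_commute: "pi1_eq p q (wh @ [l]) ([l] @ wh)"
proof -
  note pi1_eq.trans [trans]
  obtain g b where l: "l = (g, b)" by (cases l)
  have pos: "pi1_eq p q (wh @ [(g, False)]) ([(g, False)] @ wh)"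
    using pi1_eq.rel_h1 pi1_eq.rel_h2 pi1_eq.refl
    by (cases g) (auto simp: wh_def wc1_def wc2_def)
  show ?thesis
  proof (cases b)
    case False
    then show ?thesis using pos l by simp
  next
    case True
    \<comment> \<open>Insert \<open>g^-1 g\<close> in front, move \<open>h\<close> to the left past
      \<open>g\<close>, and cancel on the right.\<close>
    have "pi1_eq p q (wh @ [(g, True)]) ([(g, True), (g, False)] @ wh @ [(g, True)])"
      using pi1_eq.sym[OF pi1_cancel_context[of "[]" g True "wh @ [(g, True)]"]] by simp
    also have "pi1_eq p q \<dots> ([(g, True)] @ (wh @ [(g, False)]) @ [(g, True)])"
      using pi1_eq.cong[OF pi1_eq.sym[OF pos], of "[(g, True)]" "[(g, True)]"] by simp
    also have "pi1_eq p q \<dots> ([(g, True)] @ wh)"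
      using pi1_cancel_context[of "[(g, True)] @ wh" g False "[]"] by simp
    finally show ?thesis using True l by simp
  qed
qed

lemma wh_commute: "pi1_eq p q (wh @ w) (w @ wh)"
proof (induction w)
  case Nil
  show ?case by (simp add: pi1_eq.refl)
next
  case (Cons l w)
  note pi1_eq.trans [trans]
  have "pi1_eq p q (wh @ l # w) ([l] @ wh @ w)"
    using pi1_eq.cong[OF wh_letter_commute[of l], of "[]" w] by simp
  also have "pi1_eq p q \<dots> ((l # w) @ wh)"
    using pi1_eq.cong[OF Cons.IH, of "[l]" "[]"] by simp
  finally show ?case .
qed

lemma winv_single [simp]: "winv [(g, b)] = [(g, \<not> b)]"
  by (simp add: winv_def)

text \<open>\<open>expansion v x\<close> is the trace of \<open>v x\<close> for a word \<open>v\<close> and \<open>x\<close> in the quaternion algebra.\<close>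

fun expansion :: "word \<Rightarrow> quat \<Rightarrow> word mpoly" where
  "expansion v (Quat r0 r1 r2 r3) = trace_map r0 * t v + trace_map r1 * t (v @ wc1)
     + trace_map r2 * t (v @ wc2) + trace_map r3 * t (v @ wc1 @ wc2)"

lemma trace_map_simps [simp]:
  "trace_map (f + g) = trace_map f + trace_map g" "trace_map (f - g) = trace_map f - trace_map g"
  "trace_map (f * g) = trace_map f * trace_map g" "trace_map (- f) = - trace_map f"
  "trace_map 0 = 0" "trace_map 1 = 1" "trace_map (mvar v) = t (svar_word v)"
  "trace_map (chebS k f) = chebS k (trace_map f)" "trace_map (numeral n) = numeral n"
  by (simp_all add: trace_map_def)

lemma expansion_cong: "(\<And>z. t (v @ z) \<approx> t (w @ z)) \<Longrightarrow> expansion v x \<approx> expansion w x"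
proof (cases x)
  case (Quat r0 r1 r2 r3)
  assume vw: "t (v @ z) \<approx> t (w @ z)" for z
  from vw[of "[]"] have "t v \<approx> t w" by simp
  then show ?thesis
    unfolding Quat expansion.simps by (intro ideal_cong_add ideal_cong_mult ideal_cong_refl vw)
qed

lemma expansion_diff: "expansion v (x - y) = expansion v x - expansion v y"
  and expansion_qscale: "expansion v (qscale r x) = trace_map r * expansion v x"
  by (cases x; cases y; simp add: algebra_simps)+

lemma expansion_combination:
  assumes "\<And>z. t (v @ z) \<approx> f * t (v1 @ z) - t (v2 @ z)"
  shows "expansion v x \<approx> f * expansion v1 x - expansion v2 x"
proof (cases x)
  case (Quat r0 r1 r2 r3)
  have "expansion v x \<approx> trace_map r0 * (f * t v1 - t v2)
     + trace_map r1 * (f * t (v1 @ wc1) - t (v2 @ wc1))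
     + trace_map r2 * (f * t (v1 @ wc2) - t (v2 @ wc2))
     + trace_map r3 * (f * t (v1 @ wc1 @ wc2) - t (v2 @ wc1 @ wc2))"
    unfolding Quat expansion.simps
    using assms[of "[]"] by (intro ideal_cong_add ideal_cong_mult ideal_cong_refl assms) simp
  then show ?thesis by (simp add: Quat algebra_simps)
qed

lemma expansion_insert:
  "expansion (v @ g) x \<approx> t g * expansion v x - expansion (v @ winv g) x"
  by (rule expansion_combination) (use t_insert[of v g] in simp)

lemma expansion_insert_winv:
  "expansion (v @ winv g) x \<approx> t g * expansion v x - expansion (v @ g) x"
  by (rule expansion_combination) (use t_insert_winv[of v g] in simp)

text \<open>Appending \<open>c1\<close> matches left multiplication by \<open>a\<close> because,
  under the trace and in any context, \<open>c1 c1\<close> obeys the rule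
  \<open>a^2 = x1 a - 1\<close>.\<close>

lemma expansion_wc1: "expansion (v @ wc1) x \<approx> expansion v (qa * x)"
proof (cases x)
  case (Quat r0 r1 r2 r3)
  have sq: "t (v @ wc1 @ wc1 @ z) \<approx> t wc1 * t (v @ wc1 @ z) - t (v @ z)" for z
  proof -
    have "t (v @ wc1 @ wc1 @ z) \<approx> t wc1 * t (v @ wc1 @ z) - t ((v @ wc1) @ winv wc1 @ z)"
      using t_insert[of "v @ wc1" wc1 z] by simp
    also have "\<dots> \<approx> t wc1 * t (v @ wc1 @ z) - t (v @ z)"
      using pi1_cancel_context[of v Gc1 False z]
      by (intro ideal_cong_diff ideal_cong_refl t_pi1_eq) (simp add: wc1_def)
    finally show ?thesis .
  qed
  have "expansion (v @ wc1) x \<approx> trace_map r0 * t (v @ wc1)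
      + trace_map r1 * (t wc1 * t (v @ wc1) - t v) + trace_map r2 * t (v @ wc1 @ wc2)
      + trace_map r3 * (t wc1 * t (v @ wc1 @ wc2) - t (v @ wc2))"
    unfolding Quat expansion.simps append_assoc
    using sq[of "[]"] sq[of wc2] by (intro ideal_cong_add ideal_cong_mult ideal_cong_refl) simp_all
  also have "\<dots> = expansion v (qa * x)"
    by (simp add: Quat qa_def svar_word_def wc_def algebra_simps)
  finally show ?thesis .
qed

lemma expansion_wc2: "expansion (v @ wc2) x \<approx> expansion v (qb * x)"
proof (cases x)
  case (Quat r0 r1 r2 r3)
  let ?x1 = "t wc1" and ?x2 = "t wc2" and ?x3 = "t (wc1 @ wc2)"
  have inv1: "t (v @ winv wc1) \<approx> ?x1 * t v - t (v @ wc1)" for v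
    using t_insert_winv[of v wc1 "[]"] by simp
  have sq: "t (v @ wc2 @ wc2) \<approx> ?x2 * t (v @ wc2) - t v"
  proof -
    have "t (v @ wc2 @ wc2) \<approx> ?x2 * t (v @ wc2) - t ((v @ wc2) @ winv wc2)"
      using t_insert[of "v @ wc2" wc2 "[]"] by simp
    also have "\<dots> \<approx> ?x2 * t (v @ wc2) - t v"
      using pi1_cancel_context[of v Gc2 False "[]"]
      by (intro ideal_cong_diff ideal_cong_refl t_pi1_eq) (simp add: wc2_def)
    finally show ?thesis .
  qed
  have winv12: "winv (wc1 @ wc2) = winv wc2 @ winv wc1"
    by (simp add: wc1_def wc2_def winv_def)
  \<comment> \<open>Expanding the block \<open>c1 c2\<close>, and expanding \<open>c2\<close> in
    front of \<open>c1^-1\<close>, both produce the trace of \<open>v c2^-1 c1^-1\<close>;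
    eliminating it leaves the rule for \<open>b a\<close>.\<close>
  have ba: "t (v @ wc2 @ wc1) \<approx> (?x3 - ?x1 * ?x2) * t v + ?x2 * t (v @ wc1) + ?x1 * t (v @ wc2)
      - t (v @ wc1 @ wc2)"
  proof -
    have 1: "t (v @ wc1 @ wc2) \<approx> ?x3 * t v - t (v @ winv wc2 @ winv wc1)"
      using t_insert[of v "wc1 @ wc2" "[]"] by (simp add: winv12)
    have 2: "t (v @ wc2 @ winv wc1) \<approx> ?x2 * t (v @ winv wc1) - t (v @ winv wc2 @ winv wc1)"
      using t_insert[of v wc2 "winv wc1"] by simp
    have 3: "t (v @ wc2 @ winv wc1) \<approx> ?x1 * t (v @ wc2) - t (v @ wc2 @ wc1)"
      using inv1[of "v @ wc2"] by simp
    note facts = 1[unfolded ideal_cong_def] 2[unfolded ideal_cong_def] 3[unfolded ideal_cong_def]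
      inv1[of v, unfolded ideal_cong_def]
    have "t (v @ wc2 @ wc1) - ((?x3 - ?x1 * ?x2) * t v + ?x2 * t (v @ wc1) + ?x1 * t (v @ wc2)
        - t (v @ wc1 @ wc2))
      = (t (v @ wc1 @ wc2) - (?x3 * t v - t (v @ winv wc2 @ winv wc1)))
      - (t (v @ wc2 @ winv wc1) - (?x2 * t (v @ winv wc1) - t (v @ winv wc2 @ winv wc1)))
      + (t (v @ wc2 @ winv wc1) - (?x1 * t (v @ wc2) - t (v @ wc2 @ wc1)))
      - ?x2 * (t (v @ winv wc1) - (?x1 * t v - t (v @ wc1)))"
      by (simp add: algebra_simps)
    also have "\<dots> \<in> ideal_gen (char_rels p q)"
      by (rule facts | rule ideal_gen_rules)+
    finally show ?thesis unfolding ideal_cong_def .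
  qed
  \<comment> \<open>The rule \<open>b (a b) = x3 b - a^-1\<close>, obtained by treating
    \<open>c1 c2\<close> as one block after \<open>c2\<close>.\<close>
  have bab: "t (v @ wc2 @ wc1 @ wc2) \<approx> ?x3 * t (v @ wc2) - (?x1 * t v - t (v @ wc1))"
  proof -
    have "t (v @ wc2 @ wc1 @ wc2) \<approx> ?x3 * t (v @ wc2) - t (v @ wc2 @ winv wc2 @ winv wc1)"
      using t_insert[of "v @ wc2" "wc1 @ wc2" "[]"] by (simp add: winv12)
    also have "\<dots> \<approx> ?x3 * t (v @ wc2) - t (v @ winv wc1)"
      using pi1_cancel_context[of v Gc2 False "winv wc1"]
      by (intro ideal_cong_diff ideal_cong_refl t_pi1_eq) (simp add: wc2_def)
    also have "\<dots> \<approx> ?x3 * t (v @ wc2) - (?x1 * t v - t (v @ wc1))"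
      by (intro ideal_cong_diff ideal_cong_refl inv1)
    finally show ?thesis .
  qed
  have "expansion (v @ wc2) x \<approx> trace_map r0 * t (v @ wc2)
      + trace_map r1 * ((?x3 - ?x1 * ?x2) * t v + ?x2 * t (v @ wc1) + ?x1 * t (v @ wc2)
          - t (v @ wc1 @ wc2))
      + trace_map r2 * (?x2 * t (v @ wc2) - t v)
      + trace_map r3 * (?x3 * t (v @ wc2) - (?x1 * t v - t (v @ wc1)))"
    unfolding Quat expansion.simps append_assoc
    by (intro ideal_cong_add ideal_cong_mult ideal_cong_refl sq ba bab)
  also have "\<dots> = expansion v (qb * x)"
    by (simp add: Quat qb_def svar_word_def wc_def algebra_simps)
  finally show ?thesis .
qed

text \<open>Inserting an inverse word has the same shape as \<open>qconj y = tr0 y - y\<close>, so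
  inverse letters need no separate multiplication rules.\<close>

lemma expansion_inverse:
  assumes "\<And>v. expansion (v @ g) x \<approx> expansion v (y * x)" and "t g = trace_map (tr0 y)"
  shows "expansion (v @ winv g) x \<approx> expansion v (qconj y * x)"
proof -
  have "expansion (v @ winv g) x \<approx> t g * expansion v x - expansion (v @ g) x"
    by (rule expansion_insert_winv)
  also have "\<dots> \<approx> t g * expansion v x - expansion v (y * x)"
    by (intro ideal_cong_diff ideal_cong_refl assms)
  also have "\<dots> = expansion v (qconj y * x)"
    by (simp add: qconj_def left_diff_distrib expansion_diff qscale_mult_left expansion_qscale assms)
  finally show ?thesis .
qed

lemma expansion_letter:
  assumes "g \<noteq> Gh"
  shows "expansion (v @ [(g, b)]) x \<approx> expansion v (letter_quat (g, b) * x)"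
  using assms expansion_wc1[of v x] expansion_wc2[of v x]
    expansion_inverse[OF expansion_wc1, of v x] expansion_inverse[OF expansion_wc2, of v x]
  by (cases g) (auto simp: wc1_def wc2_def qa_def qb_def svar_word_def wc_def)

lemma expansion_wh: "expansion (v @ wh) x \<approx> expansion (wh @ v) x"
  using t_pi1_eq[OF pi1_eq.cong[OF pi1_eq.sym[OF wh_commute[of v]], of "[]"]]
  by (intro expansion_cong) simp

lemma expansion_wh_inverse: "expansion (wh @ v @ winv wh) x \<approx> expansion v x"
proof (rule expansion_cong)
  fix z
  note pi1_eq.trans [trans]
  have "pi1_eq p q (wh @ v @ winv wh @ z) (v @ wh @ winv wh @ z)"
    using pi1_eq.cong[OF wh_commute[of v], of "[]" "winv wh @ z"] by simp
  also have "pi1_eq p q \<dots> (v @ z)"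
    using pi1_cancel_context[of v Gh False z] by (simp add: wh_def)
  finally show "t ((wh @ v @ winv wh) @ z) \<approx> t (v @ z)"
    using t_pi1_eq by simp
qed

text \<open>The counterpart of \<open>trh\<close> in the character ring. Letters pass from
  \<open>w\<close> to \<open>v\<close> one at a time: \<open>c1\<close> and \<open>c2\<close> are
  absorbed into the quaternion, while \<open>h\<close> shifts the Chebyshev index. Hence
  \<open>v\<close> stays arbitrary in the induction.\<close>

lemma t_expansion:
  "t (v @ w) \<approx> chebS (word_exp w) (t wh) * expansion (wh @ v) (word_quat w)
     - chebS (word_exp w - 1) (t wh) * expansion v (word_quat w)"
proof (induction w arbitrary: v)
  case Nil
  show ?case by (simp add: one_quat_def ideal_cong_refl)
next
  case (Cons l w)
  obtain g b where l: "l = (g, b)" by (cases l)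
  define k x where "k = word_exp w" and "x = word_quat w"
  define e1 e0 where "e1 = expansion (wh @ v) x" and "e0 = expansion v x"
  have IH: "t (v @ l # w) \<approx> chebS k (t wh) * expansion (wh @ v @ [l]) x
      - chebS (k - 1) (t wh) * expansion (v @ [l]) x"
    using Cons.IH[of "v @ [l]"] by (simp add: k_def x_def)
  note cong = ideal_cong_diff ideal_cong_mult ideal_cong_refl
  show ?case
  proof (cases "g = Gh")
    case False
    note IH
    also have "chebS k (t wh) * expansion (wh @ v @ [l]) x - chebS (k - 1) (t wh) * expansion (v @ [l]) x
       \<approx> chebS k (t wh) * expansion (wh @ v) (letter_quat l * x)
      - chebS (k - 1) (t wh) * expansion v (letter_quat l * x)"
      using expansion_letter[OF False, of "wh @ v" b x] expansion_letter[OF False, of v b x]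
      by (intro cong) (simp_all add: l)
    also have "letter_exp l = 0"
      using False by (cases g) (auto simp: l)
    ultimately show ?thesis
      by (simp add: word_quat_Cons word_exp_Cons k_def x_def)
  next
    case Gh: True
    have lq: "letter_quat l = 1" by (simp add: l Gh)
    show ?thesis
    proof (cases b)
      case False
      have lw: "[l] = wh" by (simp add: l Gh False wh_def)
      \<comment> \<open>Two letters \<open>h\<close> meet here, and \<open>h^2 = u h - 1\<close>
        supplies one step of the recurrence.\<close>
      have 1: "expansion (wh @ v @ wh) x \<approx> t wh * e1 - e0"
      proof -
        have "expansion ((wh @ v) @ wh) x \<approx> t wh * e1 - expansion ((wh @ v) @ winv wh) x"
          unfolding e1_def by (rule expansion_insert)
        also have "\<dots> \<approx> t wh * e1 - e0"
          using expansion_wh_inverse[of v x] unfolding e0_def by (intro cong) simp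
        finally show ?thesis by simp
      qed
      have 2: "expansion (v @ wh) x \<approx> e1"
        unfolding e1_def by (rule expansion_wh)
      note IH[unfolded lw]
      also have "chebS k (t wh) * expansion (wh @ v @ wh) x - chebS (k - 1) (t wh) * expansion (v @ wh) x
          \<approx> chebS k (t wh) * (t wh * e1 - e0) - chebS (k - 1) (t wh) * e1"
        by (intro cong 1 2)
      also have "\<dots> = chebS (k + 1) (t wh) * e1 - chebS k (t wh) * e0"
        unfolding chebS_rec[of k] by (simp add: algebra_simps)
      finally show ?thesis
        by (simp add: word_quat_Cons word_exp_Cons lq e1_def e0_def k_def x_def)
          (simp add: l Gh False add.commute)
    next
      case True
      have lw: "[l] = winv wh" by (simp add: l Gh True wh_def)
      have 1: "expansion (wh @ v @ winv wh) x \<approx> e0"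
        unfolding e0_def by (rule expansion_wh_inverse)
      have 2: "expansion (v @ winv wh) x \<approx> t wh * e0 - e1"
      proof -
        have "expansion (v @ winv wh) x \<approx> t wh * e0 - expansion (v @ wh) x"
          unfolding e0_def by (rule expansion_insert_winv)
        also have "\<dots> \<approx> t wh * e0 - e1"
          unfolding e1_def by (intro cong expansion_wh)
        finally show ?thesis .
      qed
      have c: "chebS (k - 2) (t wh) = t wh * chebS (k - 1) (t wh) - chebS k (t wh)"
        using chebS_rec[of "k - 1" "t wh"] by simp
      note IH[unfolded lw]
      also have "chebS k (t wh) * expansion (wh @ v @ winv wh) x
            - chebS (k - 1) (t wh) * expansion (v @ winv wh) x
          \<approx> chebS k (t wh) * e0 - chebS (k - 1) (t wh) * (t wh * e0 - e1)"
        by (intro cong 1 2)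
      also have "\<dots> = chebS (k - 1) (t wh) * e1 - chebS (k - 2) (t wh) * e0"
        by (simp add: c algebra_simps)
      finally show ?thesis
        by (simp add: word_quat_Cons word_exp_Cons lq e1_def e0_def k_def x_def)
          (simp add: l Gh True)
    qed
  qed
qed

lemma t_word_trace: "t w \<approx> trace_map (word_trace w)"
proof -
  obtain r0 r1 r2 r3 where x: "word_quat w = Quat r0 r1 r2 r3" by (cases "word_quat w")
  have "expansion wh (word_quat w) = trace_map (tr1 (word_quat w))"
    by (simp add: x svar_word_def wc_def algebra_simps)
  \<comment> \<open>Only a congruence: the coefficient of 1 is weighted by \<open>t []\<close> on
    the left and by 2 in \<open>tr0\<close>.\<close>
  moreover have "expansion [] (word_quat w) \<approx> trace_map (tr0 (word_quat w))"
  proof -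
    have "expansion [] (word_quat w) \<approx> trace_map r0 * 2 + trace_map r1 * t wc1
        + trace_map r2 * t wc2 + trace_map r3 * t (wc1 @ wc2)"
      unfolding x expansion.simps append_Nil
      by (intro ideal_cong_add ideal_cong_mult ideal_cong_refl t_Nil)
    then show ?thesis
      by (simp add: x svar_word_def wc_def algebra_simps)
  qed
  ultimately have "chebS (word_exp w) (t wh) * expansion (wh @ []) (word_quat w)
        - chebS (word_exp w - 1) (t wh) * expansion [] (word_quat w)
      \<approx> chebS (word_exp w) (t wh) * trace_map (tr1 (word_quat w))
        - chebS (word_exp w - 1) (t wh) * trace_map (tr0 (word_quat w))"
    by (intro ideal_cong_diff ideal_cong_mult ideal_cong_refl) (simp_all add: ideal_cong_refl)
  also have "\<dots> = trace_map (word_trace w)"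
    by (simp add: word_trace_def trh_def svar_word_def)
  finally show ?thesis
    using t_expansion[of "[]" w] ideal_cong_trans by auto
qed

text \<open>Yields surjectivity with an explicit preimage.\<close>

lemma trace_map_word_trace: "f \<approx> trace_map (msubst word_trace f)"
proof -
  have "msubst mvar f \<approx> msubst (\<lambda>w. trace_map (word_trace w)) f"
    by (intro msubst_ideal_cong t_word_trace)
  then show ?thesis
    by (simp add: msubst_mvar_id trace_map_def msubst_msubst)
qed

text \<open>To place a polynomial in the kernel it now suffices to exhibit it as the
  \<open>word_trace\<close> image of a defining relation; what remains is a computation in the
  polynomial ring.\<close>

lemma trace_map_rels:
  assumes "f \<in> char_rels p q"
  shows "trace_map (msubst word_trace f) \<in> ideal_gen (char_rels p q)"
  using ideal_cong_mem_iff[OF trace_map_word_trace[of f]] ideal_gen_base[OF assms] by blast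

section \<open>The Seifert relations hold in the character ring\<close>

abbreviation (input) in_K :: "svar mpoly \<Rightarrow> bool" where
  "in_K g \<equiv> trace_map g \<in> ideal_gen (char_rels p q)"

lemma in_K_comm: "in_K (word_trace (v @ w) - word_trace (w @ v))"
  using trace_map_rels[of "mvar (v @ w) - mvar (w @ v)"] by (auto simp: char_rels_def)

lemma in_K_mult: "in_K (word_trace (v @ w) + word_trace (v @ winv w) - word_trace v * word_trace w)"
  using trace_map_rels[of "mvar (v @ w) + mvar (v @ winv w) - mvar v * mvar w"]
  by (auto simp: char_rels_def)

lemma in_K_power_defect:
  assumes "i \<in> {1, 2, 3}" "0 \<le> p i"
  shows "in_K (power_defect p q i (word_exp v + word_exp w) (word_quat v) (word_quat w))"
proof -
  let ?l = "v @ wpow wh (q i) @ w" and ?r = "v @ wpow (wc i) (p i) @ w"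
  have "pi1_eq p q ?l ?r"
    using assms(1) by (intro pi1_eq.cong pi1_eq.sym[OF pi1_eq.rel_c])
  then have "mvar ?l - mvar ?r \<in> char_rels p q"
    unfolding char_rels_def by blast
  from trace_map_rels[OF this] have "in_K (word_trace ?l - word_trace ?r)"
    by simp
  then show ?thesis
    using word_trace_rel_c[of p i v q w] assms(2) by simp
qed

lemma in_K_uminus: "in_K (- g) \<Longrightarrow> in_K g"
  using ideal_gen_uminus[of "trace_map (- g)"] by simp

lemma in_K_rel1:
  assumes i: "i \<in> {1, 2, 3}"
  shows "in_K (u^2 + (mvar (xv i))^2 + (mvar (yv i))^2 - u * mvar (xv i) * mvar (yv i) - 4)"
proof (rule in_K_uminus)
  \<comment> \<open>The trace relation for the word \<open>h c_i\<close> with itself; its second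
    term is the trace of 1.\<close>
  have "- (u^2 + (mvar (xv i))^2 + (mvar (yv i))^2 - u * mvar (xv i) * mvar (yv i) - 4) =
      word_trace ((wh @ wc i) @ (wh @ wc i)) + word_trace ((wh @ wc i) @ winv (wh @ wc i))
        - word_trace (wh @ wc i) * word_trace (wh @ wc i)"
    using trh_rec[of 1 "qgen i * qgen i"] tr0_qgen[OF i] tr1_qgen[OF i]
    by (simp add: word_trace_def qgen_inverse[OF i] qgen_sqr[OF i] power2_eq_square algebra_simps)
  then show "in_K (- (u^2 + (mvar (xv i))^2 + (mvar (yv i))^2 - u * mvar (xv i) * mvar (yv i) - 4))"
    using in_K_mult[of "wh @ wc i" "wh @ wc i"] by simp
qed

lemma in_K_rel2:
  "in_K (2 * y1 - (u * x1 + x2 * y3 - x3 * y2))"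
  "in_K (2 * y2 - (u * x2 + x1 * y3 - x3 * y1))"
proof -
  \<comment> \<open>Cyclicity of \<open>h c1 c2\<close> against \<open>c2^-1\<close>: one order
    cancels to \<open>h c1\<close>, the other is expanded through the conjugate of
    \<open>b\<close>.\<close>
  have "2 * y1 - (u * x1 + x2 * y3 - x3 * y2) =
      word_trace ((wh @ wc1 @ wc2) @ winv wc2) - word_trace (winv wc2 @ (wh @ wc1 @ wc2))"
    by (simp add: word_trace_def qconj_def quat_defs algebra_simps)
  then show "in_K (2 * y1 - (u * x1 + x2 * y3 - x3 * y2))"
    using in_K_comm[of "wh @ wc1 @ wc2" "winv wc2"] by metis
  have "2 * y2 - (u * x2 + x1 * y3 - x3 * y1) =
      word_trace (winv wc1 @ (wh @ wc1 @ wc2)) - word_trace ((wh @ wc1 @ wc2) @ winv wc1)"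
    by (simp add: word_trace_def qconj_def quat_defs algebra_simps)
  then show "in_K (2 * y2 - (u * x2 + x1 * y3 - x3 * y1))"
    using in_K_comm[of "winv wc1" "wh @ wc1 @ wc2"] by metis
qed

lemma in_K_rel3: "in_K (2 * y3 - (u * (x3 - x1 * x2) + y1 * x2 + y2 * x1))"
proof -
  have "2 * y3 - (u * (x3 - x1 * x2) + y1 * x2 + y2 * x1) =
      word_trace ((wh @ wc1) @ wc2) - word_trace (wc2 @ (wh @ wc1))"
    by (simp add: word_trace_def quat_defs algebra_simps)
  then show ?thesis
    using in_K_comm[of "wh @ wc1" wc2] by metis
qed

lemma in_K_rel4: "in_K (2 * x3 - (u * y3 + x1 * x2 - y1 * y2))"
proof (rule in_K_uminus)
  have "- (2 * x3 - (u * y3 + x1 * x2 - y1 * y2)) =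
      word_trace ((wh @ wc1) @ (wh @ wc2)) + word_trace ((wh @ wc1) @ winv (wh @ wc2))
        - word_trace (wh @ wc1) * word_trace (wh @ wc2)"
    using trh_rec[of 1 "qa * qb"]
    by (simp add: word_trace_def qconj_def quat_defs algebra_simps)
  then show "in_K (- (2 * x3 - (u * y3 + x1 * x2 - y1 * y2)))"
    using in_K_mult[of "wh @ wc1" "wh @ wc2"] by metis
qed

lemma in_K_seifert_rels:
  assumes p: "\<forall>i\<in>{1, 2, 3}. 0 \<le> p i" and s: "s \<in> seifert_rels p q"
  shows "in_K s"
proof -
  \<comment> \<open>Most relations are defects at particular arguments, so it remains to name words
    \<open>v\<close> and \<open>w\<close> that realize the exponent and both quaternions.\<close>
  have pd: "in_K (power_defect p q i k x y)"
    if "i \<in> {1, 2, 3}" "k = word_exp v + word_exp w" "x = word_quat v" "y = word_quat w"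
    for i k x y v w
    using in_K_power_defect[of i v w] that p by simp
  have basic: "in_K (power_defect p q i 0 1 1)" "in_K (power_defect p q i 1 1 1)"
    "in_K (power_defect p q i 0 (qgen i) 1)" "in_K (power_defect p q i 1 (qgen i) 1)"
    if "i \<in> {1, 2, 3}" for i
    using pd[OF that, of 0 "[]" "[]"] pd[OF that, of 1 "wh" "[]"]
      pd[OF that, of 0 "wc i" "[]"] pd[OF that, of 1 "wh @ wc i" "[]"] by simp_all
  have mixed: "in_K (power_defect p q i 0 1 qb)" "in_K (power_defect p q i 1 1 qb)"
    "in_K (power_defect p q i 0 qa 1)" "in_K (power_defect p q i 1 qa 1)"
    "in_K (power_defect p q i 0 1 (qa * qb))" "in_K (power_defect p q i 0 (qa * qb) 1)"
    if "i \<in> {1, 2, 3}" for i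
    using pd[OF that, of 0 "[]" wc2] pd[OF that, of 1 wh wc2] pd[OF that, of 0 wc1 "[]"]
      pd[OF that, of 1 "wh @ wc1" "[]"] pd[OF that, of 0 "[]" "wc1 @ wc2"]
      pd[OF that, of 0 "wc1 @ wc2" "[]"] by simp_all
  have xy: "xv 1 = X1" "xv 2 = X2" "xv 3 = X3" "yv 1 = Y1" "yv 2 = Y2" "yv 3 = Y3"
    by (simp_all add: xv_def yv_def)
  have mem: "1 \<in> {1, 2, 3 :: nat}" "2 \<in> {1, 2, 3 :: nat}" "3 \<in> {1, 2, 3 :: nat}"
    by simp_all
  note mixed = mixed[OF mem(1)] mixed[OF mem(2)] mixed[OF mem(3)]
  have pi: "0 \<le> p i" if "i \<in> {1, 2, 3}" for i
    using p that by blast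
  have ij: "i = 1 \<and> j = 2 \<or> i = 2 \<and> j = 1" if "(i, j) \<in> {(1, 2), (2, 1)}" for i j :: nat
    using that by auto
  \<comment> \<open>Excluding \<open>j = 3\<close> leaves four permutations, one for each equation
    of \<open>rel10_defect\<close>.\<close>
  have ijk: "i = 1 \<and> j = 2 \<and> k = 3 \<or> i = 2 \<and> j = 1 \<and> k = 3
      \<or> i = 3 \<and> j = 1 \<and> k = 2 \<or> i = 3 \<and> j = 2 \<and> k = 1"
    if "i \<in> {1, 2, 3}" "j \<in> {1, 2, 3}" "k \<in> {1, 2, 3}" "i \<noteq> j" "j \<noteq> k" "i \<noteq> k" "j \<noteq> 3"
    for i j k :: nat
    using that by auto
  note single = rel5_defect[where p = p, OF pi] rel6_defect[where p = p, OF pi]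
    rel7_defect[where p = p, OF pi] rel9_defect[where p = p, OF pi]
  note double = rel8_defect[where p = p, OF p] rel10_defect[where p = p, OF p]
    rel11_defect[where p = p, OF p] rel12_defect[where p = p, OF p]
  note rels = xy in_K_rel1 in_K_rel2 in_K_rel3 in_K_rel4 single double basic mixed
  show ?thesis
    using s unfolding seifert_rels_def Let_def
    by - (elim UnE CollectE exE conjE singletonE;
        (drule ij | drule (6) ijk)?; (elim disjE conjE)?; simp only: rels)
qed

end

text \<open>The isomorphism of quotients is phrased through \<open>trace_map\<close>: the first
  conjunct is surjectivity, and the equivalence combines well-definedness with injectivity.\<close>

theorem theorem3p4:
  fixes p q :: "nat \<Rightarrow> int"
  assumes "\<forall>i\<in>{1, 2, 3}. 2 \<le> p i"
    and "\<forall>i\<in>{1, 2, 3}. coprime (p i) (q i)"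
  shows "(\<forall>f :: word mpoly. \<exists>g. f - trace_map g \<in> char_ideal p q)
       \<and> (\<forall>g. trace_map g \<in> char_ideal p q \<longleftrightarrow> g \<in> seifert_ideal p q)"
proof (intro conjI allI)
  fix f :: "word mpoly"
  show "\<exists>g. f - trace_map g \<in> char_ideal p q"
    using trace_map_word_trace[of p q f] by (auto simp: ideal_cong_def char_ideal_def)
next
  have p: "\<forall>i\<in>{1, 2, 3}. 0 \<le> p i"
    using assms(1) by fastforce
  fix g
  \<comment> \<open>The composite is the identity on the polynomial ring itself, so substituting
    \<open>word_trace\<close> into a member of the character ideal recovers \<open>g\<close> inside
    the Seifert ideal.\<close>
  have retract: "msubst word_trace (trace_map g) = g"
    by (simp add: trace_map_def msubst_msubst word_trace_svar_word msubst_mvar_id)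
  show "trace_map g \<in> char_ideal p q \<longleftrightarrow> g \<in> seifert_ideal p q"
  proof
    assume "trace_map g \<in> char_ideal p q"
    then have "msubst word_trace (trace_map g) \<in> ideal_gen (seifert_rels p q)"
      unfolding char_ideal_def
      using msubst_ideal_gen[of "char_rels p q" word_trace] word_trace_char_rels[OF assms(1)] by metis
    then show "g \<in> seifert_ideal p q"
      by (simp add: retract seifert_ideal_def)
  next
    assume "g \<in> seifert_ideal p q"
    moreover have "msubst (\<lambda>v. mvar (svar_word v)) s \<in> ideal_gen (char_rels p q)"
      if "s \<in> seifert_rels p q" for s
      using in_K_seifert_rels[OF p that] by (simp add: trace_map_def)
    ultimately show "trace_map g \<in> char_ideal p q"
      unfolding seifert_ideal_def char_ideal_def trace_map_def using msubst_ideal_gen by metis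
  qed
qed

end
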